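(* Let $k\ge 1$ and $n$ be integers with $2k<n$. The forest $P_n^k$ consisting of $k-1$ copies of $P_2$ together with one path $P_{n-2k+2}$ is the unique forest in $\mathcal{F}_n^k$ with maximum energy.
   Context: $\mathcal{F}_n^k$ denotes the set of (simple, unweighted) forests with $n$ vertices and exactly $k$ connected components. $P_j$ denotes the path on $j$ vertices. The energy of a graph is the sum of the absolute values of the eigenvalues of its adjacency matrix. Uniqueness is up to isomorphism. *)

theory Defs
  imports
    "Graph_Theory.Graph_Theory"
    "Jordan_Normal_Form.Char_Poly"
    "HOL-Computational_Algebra.Fundamental_Theorem_Algebra"
begin

text \<open>
  A finite simple graph is a \<^locale>\<open>pair_graph\<close>: an edge between u and v is represented by
  the two arcs (u, v) and (v, u).

  The library predicate \<^const>\<open>forest\<close> is not usable for such graphs, because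
  \<^const>\<open>pre_digraph.cycle\<close> also holds of the closed walk that traverses a single edge back and
  forth.  The cycles of the undirected graph are the library cycles of length at least 3.
\<close>

definition undirected_forest :: "'a pair_pre_digraph \<Rightarrow> bool" where
  "undirected_forest G \<longleftrightarrow>
     pair_graph G \<and> \<not> (\<exists>p. pre_digraph.cycle (with_proj G) p \<and> length p \<ge> 3)"

text \<open>In a symmetric digraph the strongly connected components are the connected components.\<close>

definition forests :: "nat \<Rightarrow> nat \<Rightarrow> 'a pair_pre_digraph set" where
  "forests n k = {G. undirected_forest G \<and> card (pverts G) = n \<and>
                     card (pre_digraph.sccs (with_proj G)) = k}"

definition isomorphic :: "'a pair_pre_digraph \<Rightarrow> 'b pair_pre_digraph \<Rightarrow> bool" where
  "isomorphic G H \<longleftrightarrow> digraph_iso (with_proj G) (with_proj H)"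

definition adjacency_matrix :: "'a pair_pre_digraph \<Rightarrow> 'a list \<Rightarrow> complex mat" where
  "adjacency_matrix G vs =
     mat (length vs) (length vs) (\<lambda>(i, j). if (vs ! i, vs ! j) \<in> parcs G then 1 else 0)"

text \<open>
  Eigenvalues are counted with algebraic multiplicity.  Different enumerations of the vertices
  give permutation-similar matrices, so the choice made here does not affect the value.
\<close>

definition energy :: "'a pair_pre_digraph \<Rightarrow> real" where
  "energy G =
     (let vs = (SOME vs. distinct vs \<and> set vs = pverts G)
      in \<Sum>x\<in>#proots (char_poly (adjacency_matrix G vs)). cmod x)"

definition path_graph :: "nat \<Rightarrow> nat pair_pre_digraph" where
  "path_graph j =
     \<lparr>pverts = {..<j}, parcs = {(u, v). u < j \<and> v < j \<and> (v = Suc u \<or> u = Suc v)}\<rparr>"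

definition disjoint_union ::
  "'i set \<Rightarrow> ('i \<Rightarrow> 'a pair_pre_digraph) \<Rightarrow> ('i \<times> 'a) pair_pre_digraph" where
  "disjoint_union I G =
     \<lparr>pverts = (SIGMA i:I. pverts (G i)),
      parcs = {((i, u), (j, v)) | i j u v. i \<in> I \<and> j = i \<and> (u, v) \<in> parcs (G i)}\<rparr>"

definition path_forest :: "nat \<Rightarrow> nat \<Rightarrow> (nat \<times> nat) pair_pre_digraph" where
  "path_forest n k =
     disjoint_union {..<k} (\<lambda>i. path_graph (if i < k - 1 then 2 else n - 2 * k + 2))"

end

theory Submission
  imports Defs "HOL-Real_Asymp.Real_Asymp"
begin

text \<open>
  For a multiset of real numbers a, the function sum of 2 a arctan (a x) - ln (1 + a^2 x^2) / x
  has derivative sum of ln (1 + a^2 x^2) / x^2, tends to 0 at 0 and to pi times the sum of the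
  absolute values at infinity (Coulson's formula). Applied to the spectrum of a graph, for which
  the product of the factors 1 + a^2 x^2 is the squared modulus of det (I + i x A), this reduces
  the comparison of energies to the comparison of det (I + i x A) for every x > 0.

  For a forest these determinants are positive reals. With t = x^2, deleting a leaf v with
  neighbour u gives D(G) = D(G - v) + t D(G - u - v). Induction along leaves bounds D of a forest with n
  vertices and e edges by (1 + t)^e if 2 e \<le> n, and by the value (1 + t)^(n - e - 1) p(2 e + 2 - n)
  of the extremal forest otherwise, where p(j) is the determinant of the path on j vertices.
  Equality at a single x > 0 makes all inequalities of the induction equalities, which forces
  the degree of u to be at most 2 and reconstructs the forest from the smaller ones.
\<close>

section \<open>Determinants indexed by finite sets\<close>

text \<open>In the expansion along a leaf the minus sign of a transposition meets the square
  \<open>- t\<close> of \<open>\<i> * x\<close>, so all terms are positive: the determinant of a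
  forest counts its matchings by size, weighted with powers of \<open>t\<close>. Deleting u can
  leave isolated vertices and removes as many edges as u has neighbours, so a bound restricted to 2
  e \<ge> n would not survive the induction. Hence the bound covers all pairs (n, e), with a second
  regime, and its growth in e is needed. Uniqueness meets one real obstacle: even if G - v is known
  to be a path forest, the leaf v might hang at a component P_2 beside a longer path. The equality
  for G - u - v excludes this, since the other vertex of that P_2 would be isolated there, and under
  2 e \<ge> n an isolated vertex costs strictly. Determinants are indexed by vertex sets so that
  deleting vertices is set difference, without renumbering of rows.\<close>

definition set_det :: "'a set \<Rightarrow> ('a \<Rightarrow> 'a \<Rightarrow> 'b::comm_ring_1) \<Rightarrow> 'b" where
  "set_det V A = (\<Sum>p | p permutes V. of_int (sign p) * (\<Prod>i\<in>V. A i (p i)))"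

lemma set_det_empty [simp]: "set_det {} A = 1"
  by (simp add: set_det_def)

text \<open>Conjugation by \<open>f\<close> carries the permutations of \<open>V\<close> to those of
  \<open>W\<close> and preserves the sign.\<close>

lemma set_det_bij:
  assumes f: "bij_betw f V W" and fin: "finite V"
    and A: "\<And>i j. i \<in> V \<Longrightarrow> j \<in> V \<Longrightarrow> A i j = B (f i) (f j)"
  shows "set_det V A = set_det W B"
proof -
  have inj: "inj_on f V" and W: "W = f ` V" using f by (auto simp: bij_betw_def)
  have bij: "bij_betw (map_permutation V f) {p. p permutes V} {p. p permutes W}"
  proof (rule bij_betw_byWitness[where f' = "map_permutation W (inv_into V f)"])
    show "\<forall>p\<in>{p. p permutes V}. map_permutation W (inv_into V f) (map_permutation V f p) = p"
      using map_permutation_compose_inv[OF f] f by (auto simp: bij_betw_inv_into_left)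
    show "\<forall>p\<in>{p. p permutes W}. map_permutation V f (map_permutation W (inv_into V f) p) = p"
      using map_permutation_compose_inv[OF bij_betw_inv_into[OF f]] f
      by (auto simp: bij_betw_inv_into_right)
  qed (use map_permutation_permutes[OF f] map_permutation_permutes[OF bij_betw_inv_into[OF f]]
        in \<open>auto simp: f bij_betw_inv_into\<close>)
  have "(\<Prod>i\<in>V. A i (p i)) = (\<Prod>i\<in>W. B i (map_permutation V f p i))" if p: "p permutes V" for p
    unfolding W prod.reindex[OF inj] o_def
    by (rule prod.cong) (auto simp: A permutes_in_image[OF p] map_permutation_apply[OF inj])
  then show ?thesis
    unfolding set_det_def
    by (subst sum.reindex_bij_betw[OF bij, symmetric])
      (auto intro!: sum.cong simp: sign_map_permutation[OF inj _ fin])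
qed

lemma set_det_mat:
  assumes d: "distinct vs"
  shows "set_det (set vs) A = det (mat (length vs) (length vs) (\<lambda>(i, j). A (vs ! i) (vs ! j)))"
proof -
  have "set_det (set vs) A = set_det {0..<length vs} (\<lambda>i j. A (vs ! i) (vs ! j))"
    by (rule set_det_bij[symmetric, of "\<lambda>i. vs ! i"])
      (use bij_betw_nth[OF d, of "{0..<length vs}" "set vs"] in \<open>auto simp: lessThan_atLeast0\<close>)
  also have "\<dots> = det (mat (length vs) (length vs) (\<lambda>(i, j). A (vs ! i) (vs ! j)))"
    unfolding det_def set_det_def
    by (auto intro!: sum.cong prod.cong simp: permutes_in_image)
  finally show ?thesis .
qed

lemma set_det_smult:
  assumes "finite V"
  shows "set_det V (\<lambda>i j. c * A i j) = c ^ card V * set_det V A"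
  by (simp add: set_det_def prod.distrib sum_distrib_left mult.left_commute)

text \<open>A permutation that moves \<open>v\<close> picks a zero in row \<open>v\<close>; those
  that fix \<open>v\<close> are the permutations of the remaining set.\<close>

lemma set_det_isolated:
  assumes fin: "finite V" and v: "v \<in> V" and row: "\<And>w. w \<in> V \<Longrightarrow> w \<noteq> v \<Longrightarrow> A v w = 0"
  shows "set_det V A = A v v * set_det (V - {v}) A"
proof -
  have 1: "{p. p permutes V \<and> p v = v} = {p. p permutes (V - {v})}"
    by (auto simp: permutes_not_in intro: permutes_superset permutes_subset[OF _ Diff_subset])
  have "set_det V A = (\<Sum>p | p permutes V \<and> p v = v. of_int (sign p) * (\<Prod>i\<in>V. A i (p i)))"
    unfolding set_det_def
  proof (rule sum.mono_neutral_right)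
    show "\<forall>p\<in>{p. p permutes V} - {p. p permutes V \<and> p v = v}. of_int (sign p) * (\<Prod>i\<in>V. A i (p i)) = 0"
    proof
      fix p assume "p \<in> {p. p permutes V} - {p. p permutes V \<and> p v = v}"
      hence "A v (p v) = 0" using row[of "p v"] v by (auto simp: permutes_in_image)
      hence "(\<Prod>i\<in>V. A i (p i)) = 0" using fin v by (intro prod_zero) auto
      thus "of_int (sign p) * (\<Prod>i\<in>V. A i (p i)) = 0" by simp
    qed
  qed (use fin in \<open>auto simp: finite_permutations\<close>)
  also have "\<dots> = (\<Sum>p | p permutes (V - {v}). A v v * (of_int (sign p) * (\<Prod>i\<in>V - {v}. A i (p i))))"
    unfolding 1 by (rule sum.cong)
      (auto simp: prod.remove[OF fin v] permutes_not_in)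
  finally show ?thesis by (simp add: set_det_def sum_distrib_left)
qed

text \<open>Row \<open>v\<close> forces the image of \<open>v\<close>, and column \<open>v\<close>
  its preimage, to be \<open>v\<close> or \<open>u\<close>. So the nonzero terms either fix
  \<open>v\<close> or interchange \<open>u\<close> and \<open>v\<close>; splitting off the
  transposition in the second case reverses the sign.\<close>

lemma set_det_leaf:
  fixes A :: "'a \<Rightarrow> 'a \<Rightarrow> 'b::comm_ring_1"
  assumes fin: "finite V" and v: "v \<in> V" and u: "u \<in> V" and uv: "u \<noteq> v"
    and row: "\<And>w. w \<in> V \<Longrightarrow> w \<noteq> v \<Longrightarrow> w \<noteq> u \<Longrightarrow> A v w = 0"
    and col: "\<And>w. w \<in> V \<Longrightarrow> w \<noteq> v \<Longrightarrow> w \<noteq> u \<Longrightarrow> A w v = 0"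
  shows "set_det V A = A v v * set_det (V - {v}) A - A v u * A u v * set_det (V - {v, u}) A"
proof -
  let ?t = "\<lambda>p. of_int (sign p) * (\<Prod>i\<in>V. A i (p i)) :: 'b"
  let ?P = "{p. p permutes V \<and> p v = v}" and ?Q = "{p. p permutes V \<and> p v = u \<and> p u = v}"
  have finP: "finite {p. p permutes V}" using fin by (rule finite_permutations)
  have P: "?P = {p. p permutes (V - {v})}"
    by (auto simp: permutes_not_in intro: permutes_superset permutes_subset[OF _ Diff_subset])
  have "set_det V A = sum ?t (?P \<union> ?Q)"
    unfolding set_det_def
  proof (rule sum.mono_neutral_right)
    show "\<forall>p\<in>{p. p permutes V} - (?P \<union> ?Q). ?t p = 0"
    proof
      fix p assume p: "p \<in> {p. p permutes V} - (?P \<union> ?Q)"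
      hence perm: "p permutes V" and pv: "p v \<noteq> v" by auto
      have "\<exists>i\<in>V. A i (p i) = 0"
      proof (cases "p v = u")
        case False
        thus ?thesis using row[of "p v"] pv v perm by (auto simp: permutes_in_image)
      next
        case True
        with p have pu: "p u \<noteq> v" by auto
        obtain w where pw: "p w = v" using permutes_surj[OF perm] by (metis surjD)
        have "w \<in> V" using pw v perm by (metis permutes_in_image)
        moreover have "w \<noteq> u" "w \<noteq> v" using pw pu pv by auto
        ultimately show ?thesis using col[of w] pw by auto
      qed
      hence "(\<Prod>i\<in>V. A i (p i)) = 0" by (rule prod_zero[OF fin])
      thus "?t p = 0" by simp
    qed
  qed (use finP in auto)
  also have "\<dots> = sum ?t ?P + sum ?t ?Q"
    by (rule sum.union_disjoint) (use finP uv in auto)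
  also have "sum ?t ?P = A v v * set_det (V - {v}) A"
    unfolding P set_det_def sum_distrib_left by (rule sum.cong)
      (auto simp: prod.remove[OF fin v] permutes_not_in mult.left_commute)
  also have "sum ?t ?Q = (\<Sum>p | p permutes (V - {v, u}). - (A v u * A u v * (of_int (sign p) * (\<Prod>i\<in>V - {v, u}. A i (p i)))))"
  proof (rule sum.reindex_bij_witness[where i = "\<lambda>p. Transposition.transpose u v \<circ> p" and j = "\<lambda>p. Transposition.transpose u v \<circ> p"])
    fix p assume p: "p \<in> ?Q"
    hence perm: "p permutes V" by simp
    have "Transposition.transpose u v \<circ> p permutes V"
      using permutes_compose[OF perm permutes_swap_id[OF u v]] by simp
    thus q: "Transposition.transpose u v \<circ> p \<in> {p. p permutes V - {v, u}}"
      using p uv by (auto intro!: permutes_superset[of _ V])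
    have "sign (Transposition.transpose u v \<circ> p) = - sign p"
      using permutes_imp_permutation[OF fin perm] uv
      by (simp add: sign_compose sign_swap_id permutation_swap_id)
    moreover have "(\<Prod>i\<in>V. A i (p i)) = A v u * (A u v * (\<Prod>i\<in>V - {v, u}. A i (p i)))"
      using p uv u by (subst prod.remove[OF fin v], subst prod.remove[of _ u])
        (auto simp: fin Diff_insert2 [symmetric])
    moreover have "(\<Prod>i\<in>V - {v, u}. A i ((Transposition.transpose u v \<circ> p) i)) = (\<Prod>i\<in>V - {v, u}. A i (p i))"
    proof (rule prod.cong[OF refl])
      fix i assume i: "i \<in> V - {v, u}"
      have "p i \<noteq> p u" "p i \<noteq> p v" using i permutes_inj[OF perm] by (auto dest: injD)
      thus "A i ((Transposition.transpose u v \<circ> p) i) = A i (p i)" using p by (auto simp: Transposition.transpose_def)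
    qed
    ultimately show "- (A v u * A u v * (of_int (sign (Transposition.transpose u v \<circ> p)) *
        (\<Prod>i\<in>V - {v, u}. A i ((Transposition.transpose u v \<circ> p) i)))) = ?t p"
      by (simp add: mult_ac)
  next
    fix p assume p: "p \<in> {p. p permutes V - {v, u}}"
    hence "p permutes V" using permutes_subset by (metis Diff_subset mem_Collect_eq)
    hence "Transposition.transpose u v \<circ> p permutes V"
      using permutes_compose[OF _ permutes_swap_id[OF u v]] by simp
    thus "Transposition.transpose u v \<circ> p \<in> ?Q"
      using p by (auto simp: permutes_not_in)
  qed (auto simp: o_assoc[symmetric] fun_eq_iff)
  finally show ?thesis
    by (simp add: set_det_def sum_distrib_left sum_negf)
qed

section \<open>Coulson's formula\<close>

text \<open>Integrating \<open>ln (1 + (a * x)\<^sup>2) / x\<^sup>2\<close> by parts gives this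
  antiderivative. Its monotonicity and its two limits take the place of the improper
  integral.\<close>

definition coulson :: "real \<Rightarrow> real \<Rightarrow> real" where
  "coulson a x = 2 * a * arctan (a * x) - ln (1 + (a * x)\<^sup>2) / x"

lemma coulson_deriv:
  assumes "x > 0"
  shows "(coulson a has_real_derivative ln (1 + (a * x)\<^sup>2) / x\<^sup>2) (at x)"
proof -
  have pos: "1 + (a * x)\<^sup>2 > 0" by (simp add: add_pos_nonneg)
  have "((\<lambda>x. arctan (a * x)) has_real_derivative a / (1 + (a * x)\<^sup>2)) (at x)"
    by (auto intro!: derivative_eq_intros simp: divide_inverse)
  moreover have "((\<lambda>x. ln (1 + (a * x)\<^sup>2)) has_real_derivative (2 * (a * x) * a) / (1 + (a * x)\<^sup>2)) (at x)"
    using pos by (auto intro!: derivative_eq_intros)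
  ultimately have "((\<lambda>x. 2 * a * arctan (a * x) - ln (1 + (a * x)\<^sup>2) / x) has_real_derivative
      2 * a * (a / (1 + (a * x)\<^sup>2)) -
      ((2 * (a * x) * a) / (1 + (a * x)\<^sup>2) * x - ln (1 + (a * x)\<^sup>2) * 1) / (x * x)) (at x)"
    using assms by (intro DERIV_diff DERIV_cmult DERIV_divide DERIV_ident) auto
  moreover have "2 * a * (a / (1 + (a * x)\<^sup>2)) -
      ((2 * (a * x) * a) / (1 + (a * x)\<^sup>2) * x - ln (1 + (a * x)\<^sup>2) * 1) / (x * x) = ln (1 + (a * x)\<^sup>2) / x\<^sup>2"
    using assms pos by (simp add: diff_divide_distrib power2_eq_square)
  ultimately show ?thesis by (simp add: coulson_def[abs_def])
qed

lemma coulson_at_0: "(coulson a \<longlongrightarrow> 0) (at_right 0)"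
proof -
  have "((\<lambda>x. ln (1 + (a * x)\<^sup>2) / x) \<longlongrightarrow> 0) (at_right 0)"
  proof (rule tendsto_sandwich[of "\<lambda>_. 0" _ _ "\<lambda>x. a\<^sup>2 * x"])
    show "\<forall>\<^sub>F x in at_right 0. 0 \<le> ln (1 + (a * x)\<^sup>2) / x"
      by (auto simp: eventually_at_right_less intro!: eventually_mono[OF eventually_at_right_less[of 0]])
    show "\<forall>\<^sub>F x in at_right 0. ln (1 + (a * x)\<^sup>2) / x \<le> a\<^sup>2 * x"
    proof (rule eventually_mono[OF eventually_at_right_less[of 0]])
      fix x :: real assume x: "0 < x"
      have "ln (1 + (a * x)\<^sup>2) \<le> (a * x)\<^sup>2" by (rule ln_add_one_self_le_self) simp
      thus "ln (1 + (a * x)\<^sup>2) / x \<le> a\<^sup>2 * x"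
        using x by (simp add: pos_divide_le_eq power2_eq_square mult_ac)
    qed
    show "((\<lambda>x. a\<^sup>2 * x) \<longlongrightarrow> 0) (at_right 0)" by (rule tendsto_eq_intros refl)+ simp
  qed simp
  moreover have "((\<lambda>x. 2 * a * arctan (a * x)) \<longlongrightarrow> 0) (at_right 0)"
    by (rule tendsto_eq_intros refl)+ simp
  ultimately show ?thesis
    unfolding coulson_def[abs_def] by (auto intro: tendsto_eq_intros)
qed

lemma coulson_at_top: "(coulson a \<longlongrightarrow> pi * \<bar>a\<bar>) at_top"
proof -
  have "((\<lambda>x. ln (1 + (a * x)\<^sup>2) / x) \<longlongrightarrow> 0) at_top"
  proof (cases "a = 0")
    case False
    thus ?thesis by real_asymp
  qed simp
  moreover have "((\<lambda>x. 2 * a * arctan (a * x)) \<longlongrightarrow> pi * \<bar>a\<bar>) at_top"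
  proof (cases a "0 :: real" rule: linorder_cases)
    case less
    have "filterlim (\<lambda>x. a * x) at_bot at_top" using less by real_asymp
    hence "((\<lambda>x. 2 * a * arctan (a * x)) \<longlongrightarrow> 2 * a * - (pi / 2)) at_top"
      by (intro tendsto_mult tendsto_const filterlim_compose[OF tendsto_arctan_at_bot])
    thus ?thesis using less by (simp add: mult.commute)
  next
    case greater
    have "filterlim (\<lambda>x. a * x) at_top at_top" using greater by real_asymp
    hence "((\<lambda>x. 2 * a * arctan (a * x)) \<longlongrightarrow> 2 * a * (pi / 2)) at_top"
      by (intro tendsto_mult tendsto_const filterlim_compose[OF tendsto_arctan_at_top])
    thus ?thesis using greater by (simp add: mult.commute)
  qed simp
  ultimately show ?thesis
    unfolding coulson_def[abs_def] by (auto intro: tendsto_eq_intros)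
qed

definition coulson_diff :: "real multiset \<Rightarrow> real multiset \<Rightarrow> real \<Rightarrow> real" where
  "coulson_diff L R x = (\<Sum>a\<in>#R. coulson a x) - (\<Sum>a\<in>#L. coulson a x)"

lemma tendsto_sum_mset:
  fixes f :: "'a \<Rightarrow> 'b \<Rightarrow> real"
  shows "(\<And>a. a \<in># L \<Longrightarrow> (f a \<longlongrightarrow> g a) F) \<Longrightarrow> ((\<lambda>x. \<Sum>a\<in>#L. f a x) \<longlongrightarrow> (\<Sum>a\<in>#L. g a)) F"
  by (induction L) (auto intro!: tendsto_add)

lemma DERIV_sum_mset:
  fixes f :: "'a \<Rightarrow> real \<Rightarrow> real"
  shows "(\<And>a. a \<in># L \<Longrightarrow> (f a has_real_derivative g a) (at x)) \<Longrightarrow>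
    ((\<lambda>x. \<Sum>a\<in>#L. f a x) has_real_derivative (\<Sum>a\<in>#L. g a)) (at x)"
  by (induction L) (auto intro!: DERIV_add)

lemma ln_prod_mset:
  fixes f :: "'a \<Rightarrow> real"
  shows "(\<And>a. a \<in># L \<Longrightarrow> f a > 0) \<Longrightarrow> (\<Prod>a\<in>#L. f a) > 0 \<and> ln (\<Prod>a\<in>#L. f a) = (\<Sum>a\<in>#L. ln (f a))"
  by (induction L) (auto simp: ln_mult_pos)

text \<open>The derivative of \<open>coulson_diff L R\<close> is the difference of the logarithms of
  the two products over the square of x, hence nonnegative. The function therefore stays between its
  limits at 0 and at infinity.\<close>

lemma sum_mset_abs_le:
  fixes L R :: "real multiset"
  assumes le: "\<And>x. x > 0 \<Longrightarrow> (\<Prod>a\<in>#L. 1 + (a * x)\<^sup>2) \<le> (\<Prod>a\<in>#R. 1 + (a * x)\<^sup>2)"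
  shows "(\<Sum>a\<in>#L. \<bar>a\<bar>) \<le> (\<Sum>a\<in>#R. \<bar>a\<bar>)"
    and "(\<And>x. x > 0 \<Longrightarrow> (\<Prod>a\<in>#L. 1 + (a * x)\<^sup>2) < (\<Prod>a\<in>#R. 1 + (a * x)\<^sup>2)) \<Longrightarrow>
      (\<Sum>a\<in>#L. \<bar>a\<bar>) < (\<Sum>a\<in>#R. \<bar>a\<bar>)"
proof -
  let ?D = "coulson_diff L R"
  let ?d = "\<lambda>x. (ln (\<Prod>a\<in>#R. 1 + (a * x)\<^sup>2) - ln (\<Prod>a\<in>#L. 1 + (a * x)\<^sup>2)) / x\<^sup>2"
  have pos: "(\<Prod>a\<in>#M. 1 + (a * x)\<^sup>2) > 0"
    and ln: "ln (\<Prod>a\<in>#M. 1 + (a * x)\<^sup>2) = (\<Sum>a\<in>#M. ln (1 + (a * x)\<^sup>2))" for M :: "real multiset" and x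
    using ln_prod_mset[of M "\<lambda>a. 1 + (a * x)\<^sup>2"] by (auto simp: add_pos_nonneg)
  have sumdiv: "(\<Sum>a\<in>#M. f a / c) = (\<Sum>a\<in>#M. f a) / c" for M :: "real multiset" and f and c :: real
    by (induction M) (auto simp: add_divide_distrib)
  have deriv: "(?D has_real_derivative ?d x) (at x)" if "x > 0" for x
    unfolding coulson_diff_def[abs_def] ln diff_divide_distrib sumdiv[symmetric]
    by (intro DERIV_diff DERIV_sum_mset coulson_deriv that)
  have at0: "(?D \<longlongrightarrow> 0) (at_right 0)"
    unfolding coulson_diff_def[abs_def]
    using tendsto_diff[OF tendsto_sum_mset[of R] tendsto_sum_mset[of L], OF coulson_at_0 coulson_at_0] by simp
  have top: "(?D \<longlongrightarrow> pi * ((\<Sum>a\<in>#R. \<bar>a\<bar>) - (\<Sum>a\<in>#L. \<bar>a\<bar>))) at_top"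
    unfolding coulson_diff_def[abs_def] right_diff_distrib sum_mset_distrib_left
    by (intro tendsto_diff tendsto_sum_mset coulson_at_top)
  have mono: "?D x \<le> ?D y" if "0 < x" "x \<le> y" for x y
  proof (rule DERIV_nonneg_imp_nondecreasing[OF that(2)])
    fix z assume z: "x \<le> z" "z \<le> y"
    hence "z > 0" using that by simp
    moreover have "?d z \<ge> 0" using le[OF \<open>z > 0\<close>] pos[where x=z] by (simp add: ln_mono)
    ultimately show "\<exists>d. (?D has_real_derivative d) (at z) \<and> 0 \<le> d" using deriv by blast
  qed
  have ge0: "0 \<le> ?D y" if "y > 0" for y
  proof (rule tendsto_upperbound[OF at0])
    show "\<forall>\<^sub>F x in at_right 0. ?D x \<le> ?D y"
      using eventually_at_right_real[OF that] by (rule eventually_mono) (auto intro: mono)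
  qed simp
  have D_le: "?D y \<le> pi * ((\<Sum>a\<in>#R. \<bar>a\<bar>) - (\<Sum>a\<in>#L. \<bar>a\<bar>))" if "y > 0" for y
  proof (rule tendsto_lowerbound[OF top])
    show "\<forall>\<^sub>F x in at_top. ?D y \<le> ?D x"
      using eventually_ge_at_top[of y] by (rule eventually_mono) (auto intro: mono that)
  qed simp
  have "0 \<le> pi * ((\<Sum>a\<in>#R. \<bar>a\<bar>) - (\<Sum>a\<in>#L. \<bar>a\<bar>))"
    using ge0[of 1] D_le[of 1] by simp
  thus "(\<Sum>a\<in>#L. \<bar>a\<bar>) \<le> (\<Sum>a\<in>#R. \<bar>a\<bar>)" using pi_gt_zero by (auto simp: zero_le_mult_iff)
  assume less: "\<And>x. x > 0 \<Longrightarrow> (\<Prod>a\<in>#L. 1 + (a * x)\<^sup>2) < (\<Prod>a\<in>#R. 1 + (a * x)\<^sup>2)"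
  \<comment> \<open>Strict growth between two arbitrary positive points suffices, because both
    values already lie between the two limits.\<close>
  have "?D 1 < ?D 2"
  proof (rule DERIV_pos_imp_increasing[of 1 2 ?D])
    fix z :: real assume z: "1 \<le> z" "z \<le> 2"
    hence "z > 0" by simp
    have "ln (\<Prod>a\<in>#L. 1 + (a * z)\<^sup>2) < ln (\<Prod>a\<in>#R. 1 + (a * z)\<^sup>2)"
      by (intro ln_less_cancel_iff[THEN iffD2] pos less \<open>z > 0\<close>)
    hence "?d z > 0" using \<open>z > 0\<close> by (intro divide_pos_pos) auto
    thus "\<exists>d. (?D has_real_derivative d) (at z) \<and> 0 < d" using deriv[OF \<open>z > 0\<close>] by (intro exI conjI)
  qed simp
  hence "0 < pi * ((\<Sum>a\<in>#R. \<bar>a\<bar>) - (\<Sum>a\<in>#L. \<bar>a\<bar>))"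
    using ge0[of 1] D_le[of 2] by simp
  thus "(\<Sum>a\<in>#L. \<bar>a\<bar>) < (\<Sum>a\<in>#R. \<bar>a\<bar>)" using pi_gt_zero by (auto simp: zero_less_mult_iff)
qed

section \<open>The spectrum of a graph\<close>

text \<open>This is det (I + c A) for the adjacency matrix A of the graph induced on
  \<open>V\<close>. With ones on the diagonal, isolated vertices contribute the factor 1.\<close>

definition graph_det :: "'a rel \<Rightarrow> complex \<Rightarrow> 'a set \<Rightarrow> complex" where
  "graph_det E c V = set_det V (\<lambda>u v. if u = v then 1 else if (u, v) \<in> E then c else 0)"

text \<open>The Hermitian form \<open>S\<close> of the eigenvector is real because the matrix is
  real and symmetric, and it equals \<open>l\<close> times the positive squared norm
  \<open>N\<close>.\<close>

lemma adjacency_eigenvalue_real: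
  assumes sym: "sym (parcs G)" and ev: "eigenvalue (adjacency_matrix G vs) l"
  shows "l \<in> \<real>"
proof -
  let ?A = "adjacency_matrix G vs" and ?n = "length vs"
  obtain v where v: "v \<in> carrier_vec ?n" "v \<noteq> 0\<^sub>v ?n" "?A *\<^sub>v v = l \<cdot>\<^sub>v v"
    using ev by (auto simp: eigenvalue_def eigenvector_def adjacency_matrix_def)
  define a where "a i j = (if (vs ! i, vs ! j) \<in> parcs G then 1 else 0 :: complex)" for i j
  have a_sym: "a i j = a j i" for i j using sym by (auto simp: a_def dest: symD)
  have a_cnj: "cnj (a i j) = a i j" for i j by (simp add: a_def)
  have row: "(\<Sum>j = 0..<?n. a i j * v $ j) = l * v $ i" if "i < ?n" for i
    using arg_cong[OF v(3), of "\<lambda>w. w $ i"] that v(1)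
    by (simp add: adjacency_matrix_def scalar_prod_def a_def)
  define S where "S = (\<Sum>i = 0..<?n. \<Sum>j = 0..<?n. cnj (v $ i) * a i j * v $ j)"
  define N where "N = (\<Sum>i = 0..<?n. (cmod (v $ i))\<^sup>2)"
  have "cnj S = (\<Sum>i = 0..<?n. \<Sum>j = 0..<?n. cnj (v $ j) * a j i * v $ i)"
    by (simp add: S_def a_cnj mult_ac a_sym)
  also have "\<dots> = S" unfolding S_def by (rule sum.swap)
  finally have "S \<in> \<real>" by (simp add: Reals_cnj_iff)
  have "S = (\<Sum>i = 0..<?n. cnj (v $ i) * (\<Sum>j = 0..<?n. a i j * v $ j))"
    by (simp add: S_def sum_distrib_left mult.assoc)
  also have "\<dots> = (\<Sum>i = 0..<?n. l * (v $ i * cnj (v $ i)))"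
    by (rule sum.cong) (auto simp: row)
  also have "\<dots> = l * of_real N"
    by (simp add: N_def sum_distrib_left complex_norm_square del: of_real_power)
  finally have S: "S = l * of_real N" .
  obtain i where "i < ?n" "v $ i \<noteq> 0" using v(1,2) by (metis carrier_vecD eq_vecI index_zero_vec)
  hence "N > 0" unfolding N_def by (intro sum_pos2[of _ i]) auto
  hence "l = S / of_real N" using S by simp
  with \<open>S \<in> \<real>\<close> show ?thesis by simp
qed

text \<open>The characteristic polynomial is evaluated at z = \<i> / x. There z I - A = z (I + \<i>
  x A), as the entry -1 is z times \<i> x, and a real root a satisfies
  \<open>(cmod (z - a))\<^sup>2 = (1 + (a * x)\<^sup>2) / x\<^sup>2\<close>. The powers of x on the
  two sides cancel.\<close>

lemma energy_spectrum:
  assumes sym: "sym (parcs G)" and irr: "irrefl (parcs G)" and fin: "finite (pverts G)"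
  obtains L :: "real multiset" where "energy G = (\<Sum>a\<in>#L. \<bar>a\<bar>)"
    and "\<And>x. x > 0 \<Longrightarrow>
      (\<Prod>a\<in>#L. 1 + (a * x)\<^sup>2) = (cmod (graph_det (parcs G) (\<i> * of_real x) (pverts G)))\<^sup>2"
proof -
  define vs where "vs = (SOME vs. distinct vs \<and> set vs = pverts G)"
  have vs: "distinct vs" "set vs = pverts G"
    using someI_ex[OF finite_distinct_list[OF fin]] by (auto simp: vs_def conj_commute)
  define A where "A = adjacency_matrix G vs"
  let ?n = "length vs"
  have A: "A \<in> carrier_mat ?n ?n" by (simp add: A_def adjacency_matrix_def)
  obtain as where as: "char_poly A = (\<Prod>a\<leftarrow>as. [:- a, 1:])" "length as = ?n"
    using char_poly_factorized[OF A] by blast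
  have real: "a \<in> \<real>" if "a \<in> set as" for a
  proof -
    have "poly (char_poly A) a = 0" using that by (auto simp: as poly_prod_list prod_list_zero_iff o_def)
    thus ?thesis
      using adjacency_eigenvalue_real[OF sym] eigenvalue_root_char_poly[OF A] by (auto simp: A_def)
  qed
  have "proots (\<Prod>a\<leftarrow>bs. [:- a, 1:]) = mset bs" for bs :: "complex list"
  proof (induction bs)
    case (Cons b bs)
    have "(\<Prod>a\<leftarrow>bs. [:- a, 1:]) \<noteq> 0" by (auto simp: prod_list_zero_iff)
    hence "proots ([:- b, 1:] * (\<Prod>a\<leftarrow>bs. [:- a, 1:])) = {#b#} + mset bs"
      by (subst proots_mult) (use Cons in simp_all)
    thus ?case by simp
  qed simp
  hence "proots (char_poly A) = mset as" by (simp add: as(1))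
  hence en: "energy G = (\<Sum>a\<in>#mset as. cmod a)"
    by (simp add: energy_def vs_def[symmetric] A_def)
  have "(\<Sum>a\<in>#mset as. cmod a) = (\<Sum>a\<in>#mset as. \<bar>Re a\<bar>)"
    by (intro arg_cong[of _ _ sum_mset] image_mset_cong) (auto simp: real Reals_def norm_of_real dest!: real)
  hence 1: "energy G = (\<Sum>a\<in>#mset (map Re as). \<bar>a\<bar>)"
    by (simp add: en image_mset.compositionality o_def)
  have 2: "(\<Prod>a\<in>#mset (map Re as). 1 + (a * x)\<^sup>2) =
      (cmod (graph_det (parcs G) (\<i> * of_real x) (pverts G)))\<^sup>2" if x: "x > 0" for x
  proof -
    let ?z = "\<i> / of_real x"
    have "poly (char_poly A) ?z = det (- (char_matrix A ?z))" by (rule char_poly_matrix[OF A])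
    also have "- (char_matrix A ?z) = mat ?n ?n (\<lambda>(i, j). ?z *
        (if vs ! i = vs ! j then 1 else if (vs ! i, vs ! j) \<in> parcs G then \<i> * of_real x else 0))"
      using x irr vs(1)
      by (intro eq_matI) (auto simp: char_matrix_def A_def adjacency_matrix_def irrefl_def nth_eq_iff_index_eq)
    also have "det \<dots> = ?z ^ ?n * graph_det (parcs G) (\<i> * of_real x) (pverts G)"
      unfolding graph_det_def
      by (subst set_det_mat[OF vs(1), symmetric, where A = "\<lambda>u v. ?z *
            (if u = v then 1 else if (u, v) \<in> parcs G then \<i> * of_real x else 0)"])
        (simp only: vs(2) set_det_smult[OF fin] distinct_card[OF vs(1), symmetric])
    finally have "(cmod (poly (char_poly A) ?z))\<^sup>2 =
        (1 / x\<^sup>2) ^ ?n * (cmod (graph_det (parcs G) (\<i> * of_real x) (pverts G)))\<^sup>2"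
      using x by (simp add: norm_mult norm_power norm_divide power_mult_distrib power_divide power_mult[symmetric] mult.commute)
    moreover have "(cmod (\<Prod>a\<leftarrow>bs. ?z - a))\<^sup>2 = (1 / x\<^sup>2) ^ length bs * (\<Prod>a\<leftarrow>bs. 1 + (Re a * x)\<^sup>2)"
      if "set bs \<subseteq> \<real>" for bs using that
    proof (induction bs)
      case (Cons b bs)
      then obtain r where r: "b = of_real r" by (auto elim: Reals_cases)
      have "(cmod (?z - b))\<^sup>2 = 1 / x\<^sup>2 * (1 + (Re b * x)\<^sup>2)"
      proof -
        have "?z - b = Complex (- r) (1 / x)" by (simp add: complex_eq_iff r Re_divide Im_divide power2_eq_square)
        thus ?thesis using x by (simp add: r cmod_power2 field_simps)
      qed
      with Cons show ?case by (simp add: norm_mult power_mult_distrib)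
    qed simp
    from this[of as] have "(cmod (poly (char_poly A) ?z))\<^sup>2 = (1 / x\<^sup>2) ^ ?n * (\<Prod>a\<leftarrow>as. 1 + (Re a * x)\<^sup>2)"
      using real by (auto simp: as poly_prod_list o_def)
    ultimately show ?thesis
      using x by (simp add: image_mset.compositionality o_def prod_mset_prod_list[symmetric] mset_map[symmetric] del: mset_map)
  qed
  show ?thesis using that[OF 1 2] by blast
qed

section \<open>The values of the extremal forests\<close>

text \<open>These are Fibonacci polynomials, the matching generating functions of paths. The value
  at 0 belongs to the empty graph, which remains when both vertices of P_2 are deleted.\<close>

fun path_poly :: "real \<Rightarrow> nat \<Rightarrow> real" where
  "path_poly t 0 = 1"
| "path_poly t (Suc 0) = 1"
| "path_poly t (Suc (Suc j)) = path_poly t (Suc j) + t * path_poly t j"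

text \<open>For 2 e \<le> n the extremal forest consists of e components P_2 and isolated vertices.
  Otherwise it has k = n - e components, and the exponent and the path length below are k - 1 and n
  - 2 k + 2.\<close>

definition extremal :: "real \<Rightarrow> nat \<Rightarrow> nat \<Rightarrow> real" where
  "extremal t n e = (if 2 * e \<le> n then (1 + t) ^ e
     else (1 + t) ^ (n - e - 1) * path_poly t (2 * e + 2 - n))"

context
  fixes t :: real
  assumes t: "t > 0"
begin

lemma path_poly_pos: "path_poly t j > 0"
  using t by (induction t j rule: path_poly.induct) (auto intro: add_pos_pos)

lemma path_poly_Suc_gt: "j \<ge> 1 \<Longrightarrow> path_poly t j < path_poly t (Suc j)"
  using t path_poly_pos by (cases j) auto

lemma path_poly_Suc_ge: "path_poly t j \<le> path_poly t (Suc j)"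
  using path_poly_Suc_gt[of j] by (cases j) auto

lemma path_poly_Suc_le: "path_poly t (Suc j) \<le> (1 + t) * path_poly t j"
proof (cases j)
  case (Suc i)
  thus ?thesis using t path_poly_Suc_ge[of i] by (simp add: algebra_simps)
qed (use t in auto)

lemma path_poly_Suc_less:
  assumes "j \<ge> 2" shows "path_poly t (Suc j) < (1 + t) * path_poly t j"
proof -
  obtain i where "j = Suc i" "i \<ge> 1" using assms by (cases j) auto
  thus ?thesis using t path_poly_Suc_gt[of i] by (simp add: algebra_simps)
qed

lemma path_poly_Suc_Suc_gt:
  assumes "j \<ge> 1" shows "(1 + t) * path_poly t j < path_poly t (j + 2)"
  using t path_poly_Suc_gt[OF assms] by (simp add: algebra_simps)

lemma path_poly_le_power: "path_poly t (Suc j) \<le> (1 + t) ^ j"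
proof (induction j)
  case (Suc j)
  have "path_poly t (Suc (Suc j)) \<le> (1 + t) * path_poly t (Suc j)" by (rule path_poly_Suc_le)
  also have "\<dots> \<le> (1 + t) * (1 + t) ^ j" using Suc t by (intro mult_left_mono) auto
  finally show ?case by simp
qed simp

text \<open>The second formula also holds at n = 2 e, where the long path is P_2 with value 1 + t,
  and at n = 2 e + 1, where it is P_1 with value 1. This overlap spares a case distinction when a
  recursion crosses the boundary.\<close>

lemma extremal_eq:
  assumes "e < n" "n \<le> 2 * e + 1" and exps: "a = n - e - 1" "j = 2 * e + 2 - n"
  shows "extremal t n e = (1 + t) ^ a * path_poly t j"
proof -
  consider "n < 2 * e" | "n = 2 * e" | "n = 2 * e + 1" using assms by linarith
  thus ?thesis
  proof cases
    case 2
    then obtain i where "e = Suc i" using assms by (cases e) auto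
    thus ?thesis using 2 by (simp add: extremal_def exps numeral_2_eq_2)
  qed (auto simp: extremal_def exps)
qed

lemma extremal_le_power:
  assumes "e < n" shows "extremal t n e \<le> (1 + t) ^ e"
proof (cases "2 * e \<le> n")
  case False
  hence j: "2 * e + 2 - n = Suc (2 * e + 1 - n)" by linarith
  have "extremal t n e \<le> (1 + t) ^ (n - e - 1) * (1 + t) ^ (2 * e + 1 - n)"
    using False t path_poly_le_power[of "2 * e + 1 - n"] unfolding extremal_def j
    by (auto intro!: mult_left_mono)
  also have "\<dots> = (1 + t) ^ e"
    using False assms by (simp flip: power_add)
  finally show ?thesis .
qed (simp add: extremal_def)

text \<open>All three terms have the same n - e and hence the same power of 1 + t, so only the long
  path is shortened. The assumption \<open>n < 2 * e\<close> gives it at least three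
  vertices.\<close>

lemma extremal_rec:
  assumes "e < n" "n < 2 * e"
  shows "extremal t n e = extremal t (n - 1) (e - 1) + t * extremal t (n - 2) (e - 2)"
proof -
  define j where "j = 2 * e - n"
  have "extremal t n e = (1 + t) ^ (n - e - 1) * path_poly t (Suc (Suc j))"
    "extremal t (n - 1) (e - 1) = (1 + t) ^ (n - e - 1) * path_poly t (Suc j)"
    "extremal t (n - 2) (e - 2) = (1 + t) ^ (n - e - 1) * path_poly t j"
    using assms by (intro extremal_eq; auto simp: j_def)+
  thus ?thesis by (simp add: algebra_simps)
qed

text \<open>With so few edges, isolated edges are strictly better than a leaf whose neighbour has
  another neighbour: the deletion of that neighbour costs two edges, and the bound for the second
  term lacks a factor 1 + t.\<close>

lemma extremal_rec_less:
  assumes "2 \<le> e" "2 * e \<le> n"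
  shows "extremal t (n - 1) (e - 1) + t * extremal t (n - 2) (e - 2) < extremal t n e"
proof -
  obtain i where e: "e = Suc (Suc i)" using assms by (metis Suc_le_D numeral_2_eq_2 Suc_le_mono)
  have "extremal t (n - 1) (e - 1) + t * extremal t (n - 2) (e - 2)
      \<le> (1 + t) ^ Suc i + t * (1 + t) ^ i"
    using assms t extremal_le_power[of "e - 1" "n - 1"] extremal_le_power[of "e - 2" "n - 2"]
    by (intro add_mono mult_left_mono) (auto simp: e)
  also have "\<dots> < (1 + t) ^ Suc i + t * (1 + t) ^ Suc i"
    using t by simp
  also have "\<dots> = extremal t n e"
    using assms by (simp add: extremal_def e algebra_simps)
  finally show ?thesis .
qed

text \<open>In the second regime one more edge merges a component P_2 into the long path, which
  gains by \<open>path_poly_Suc_Suc_gt\<close>.\<close>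

lemma extremal_Suc_edges:
  assumes "Suc e < n" shows "extremal t n e < extremal t n (Suc e)"
proof (cases "2 * Suc e \<le> n")
  case True
  thus ?thesis using t by (simp add: extremal_def)
next
  case False
  define j where "j = 2 * e + 2 - n"
  have j: "j \<ge> 1" using False by (simp add: j_def)
  have "extremal t n e = (1 + t) ^ Suc (n - Suc e - 1) * path_poly t j"
    using False assms by (intro extremal_eq) (auto simp: j_def)
  also have "\<dots> = (1 + t) ^ (n - Suc e - 1) * ((1 + t) * path_poly t j)" by simp
  also have "\<dots> < (1 + t) ^ (n - Suc e - 1) * path_poly t (j + 2)"
    using t path_poly_Suc_Suc_gt[OF j] by (intro mult_strict_left_mono) auto
  also have "\<dots> = extremal t n (Suc e)"
    using False assms by (intro extremal_eq[symmetric]) (auto simp: j_def)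
  finally show ?thesis .
qed

lemma extremal_strict_mono_edges:
  assumes "e < f" "f < n" shows "extremal t n e < extremal t n f"
  using assms
proof (induction f)
  case (Suc f)
  thus ?case using extremal_Suc_edges[of f n] by (cases "e = f") auto
qed simp

text \<open>The new vertex and one vertex given up by the long path form another P_2, a strict gain
  while the shortened path has at least two vertices. For n > 2 e the bound would not
  change.\<close>

lemma extremal_add_vertex_less:
  assumes "Suc e < n" "n \<le> 2 * e" shows "extremal t (n - 1) e < extremal t n e"
proof -
  define j where "j = 2 * e + 2 - n"
  have j: "j \<ge> 2" using assms by (simp add: j_def)
  have "extremal t (n - 1) e = (1 + t) ^ (n - 1 - e - 1) * path_poly t (Suc j)"
    using assms by (intro extremal_eq) (auto simp: j_def)
  also have "\<dots> < (1 + t) ^ (n - 1 - e - 1) * ((1 + t) * path_poly t j)"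
    using t path_poly_Suc_less[OF j] by (intro mult_strict_left_mono) auto
  also have "\<dots> = (1 + t) ^ Suc (n - 1 - e - 1) * path_poly t j" by simp
  also have "\<dots> = extremal t n e"
    using assms by (intro extremal_eq[symmetric]) (auto simp: j_def)
  finally show ?thesis .
qed

lemma extremal_add_vertex_le:
  assumes "Suc e < n" shows "extremal t (n - 1) e \<le> extremal t n e"
proof (cases "n \<le> 2 * e")
  case True
  thus ?thesis using extremal_add_vertex_less[OF assms] by simp
next
  case False
  hence "2 * e \<le> n" "2 * e \<le> n - 1" by auto
  thus ?thesis by (simp add: extremal_def)
qed

text \<open>With an edge and at least two components, the extremal forest has a P_2 that can be
  split off with the factor 1 + t.\<close>

lemma extremal_add_edge_component:
  assumes "e \<ge> 1" "e + 1 < n"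
  shows "(1 + t) * extremal t (n - 2) (e - 1) = extremal t n e"
proof (cases "2 * e \<le> n")
  case True
  thus ?thesis using assms by (cases e) (auto simp: extremal_def)
next
  case False
  hence "2 * (e - 1) + 2 - (n - 2) = 2 * e + 2 - n" "n - e - 1 = Suc (n - 2 - (e - 1) - 1)"
    "\<not> 2 * (e - 1) \<le> n - 2"
    using assms by auto
  thus ?thesis using False by (simp add: extremal_def)
qed

end

section \<open>Forests and leaf removal\<close>

definition nbrs :: "'a rel \<Rightarrow> 'a set \<Rightarrow> 'a \<Rightarrow> 'a set" where
  "nbrs E V u = {w \<in> V. (u, w) \<in> E}"

text \<open>Unordered pairs make the two arcs of an edge count once.\<close>

definition edges_on :: "'a rel \<Rightarrow> 'a set \<Rightarrow> 'a set set" where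
  "edges_on E V = {{u, w} | u w. u \<in> V \<and> w \<in> V \<and> (u, w) \<in> E}"

text \<open>This form of acyclicity passes to subsets at once and supplies the leaf for every
  induction; \<open>undirected_forest_iff\<close> links it to cycles.\<close>

definition acyclic_on :: "'a rel \<Rightarrow> 'a set \<Rightarrow> bool" where
  "acyclic_on E V \<longleftrightarrow> (\<forall>U \<subseteq> V. U \<noteq> {} \<longrightarrow> (\<exists>v\<in>U. card (nbrs E U v) \<le> 1))"

definition components_on :: "'a rel \<Rightarrow> 'a set \<Rightarrow> 'a set set" where
  "components_on E V = (\<lambda>a. {b. (a, b) \<in> rtrancl_on V E}) ` V"

lemma finite_nbrs [simp]: "finite V \<Longrightarrow> finite (nbrs E V u)"
  by (simp add: nbrs_def)

lemma nbrs_Diff: "nbrs E (V - W) u = nbrs E V u - W"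
  by (auto simp: nbrs_def)

lemma finite_edges_on [simp]: "finite V \<Longrightarrow> finite (edges_on E V)"
  by (rule finite_subset[of _ "(\<lambda>(u, w). {u, w}) ` (V \<times> V)"]) (auto simp: edges_on_def)

lemma acyclic_on_subset: "acyclic_on E V \<Longrightarrow> U \<subseteq> V \<Longrightarrow> acyclic_on E U"
  by (auto simp: acyclic_on_def)

text \<open>Serves to count components: the classes in \<open>V\<close> and in
  \<open>V - {v}\<close> are different sets, but they induce the same equivalence on the remaining
  vertices.\<close>

lemma card_image_eq_if_same_fibres:
  assumes "\<And>a b. a \<in> A \<Longrightarrow> b \<in> A \<Longrightarrow> f a = f b \<longleftrightarrow> g a = g b"
  shows "card (f ` A) = card (g ` A)"
proof (rule bij_betw_same_card)
  show "bij_betw (\<lambda>y. g (inv_into A f y)) (f ` A) (g ` A)"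
    unfolding bij_betw_def
  proof
    have inv: "inv_into A f (f a) \<in> A" "f (inv_into A f (f a)) = f a" if "a \<in> A" for a
      using that by (auto simp: inv_into_into f_inv_into_f)
    show "inj_on (\<lambda>y. g (inv_into A f y)) (f ` A)"
    proof (rule inj_onI)
      fix y z assume y: "y \<in> f ` A" and z: "z \<in> f ` A" and eq: "g (inv_into A f y) = g (inv_into A f z)"
      have "f (inv_into A f y) = f (inv_into A f z)"
        using assms eq inv_into_into[OF y] inv_into_into[OF z] by simp
      thus "y = z" using f_inv_into_f[OF y] f_inv_into_f[OF z] by simp
    qed
    show "(\<lambda>y. g (inv_into A f y)) ` f ` A = g ` A"
      unfolding image_image by (intro image_cong refl) (simp add: assms[symmetric] inv)
  qed
qed

locale simple_graph =
  fixes E :: "'a rel"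
  assumes sym_E: "sym E" and irrefl_E: "irrefl E"
begin

lemma E_sym: "(u, v) \<in> E \<longleftrightarrow> (v, u) \<in> E"
  using sym_E by (auto dest: symD)

lemma E_irrefl: "(u, u) \<notin> E"
  using irrefl_E by (auto simp: irrefl_def)

lemma card_edges_remove:
  assumes fin: "finite V" and v: "v \<in> V"
  shows "card (edges_on E V) = card (edges_on E (V - {v})) + card (nbrs E V v)"
proof -
  have "edges_on E V = edges_on E (V - {v}) \<union> (\<lambda>w. {v, w}) ` nbrs E V v"
  proof (intro equalityI subsetI)
    fix e assume "e \<in> edges_on E V"
    then obtain a b where e: "e = {a, b}" and ab: "a \<in> V" "b \<in> V" "(a, b) \<in> E"
      by (auto simp: edges_on_def)
    consider "a = v" | "b = v" | "a \<noteq> v" "b \<noteq> v" by blast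
    thus "e \<in> edges_on E (V - {v}) \<union> (\<lambda>w. {v, w}) ` nbrs E V v"
    proof cases
      case 1
      thus ?thesis using e ab by (auto simp: nbrs_def)
    next
      case 2
      hence "a \<in> nbrs E V v" "e = {v, a}" using e ab E_sym[of a b] by (auto simp: nbrs_def)
      thus ?thesis by blast
    next
      case 3
      thus ?thesis using e ab by (auto simp: edges_on_def)
    qed
  next
    fix e assume "e \<in> edges_on E (V - {v}) \<union> (\<lambda>w. {v, w}) ` nbrs E V v"
    thus "e \<in> edges_on E V"
    proof
      assume "e \<in> (\<lambda>w. {v, w}) ` nbrs E V v"
      then obtain w where "e = {v, w}" "w \<in> V" "(v, w) \<in> E" by (auto simp: nbrs_def)
      thus ?thesis using v unfolding edges_on_def by blast
    qed (unfold edges_on_def, blast)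
  qed
  moreover have "v \<notin> e" if "e \<in> edges_on E (V - {v})" for e
    using that unfolding edges_on_def by blast
  hence "edges_on E (V - {v}) \<inter> (\<lambda>w. {v, w}) ` nbrs E V v = {}" by blast
  moreover have "inj_on (\<lambda>w. {v, w}) (nbrs E V v)"
    by (auto simp: inj_on_def doubleton_eq_iff)
  ultimately show ?thesis
    using fin by (simp add: card_Un_disjoint card_image)
qed

lemma acyclic_on_cases [consumes 3, case_names isolated leaf]:
  assumes "acyclic_on E V" "finite V" "V \<noteq> {}"
  obtains (isolated) v where "v \<in> V" "nbrs E V v = {}"
  | (leaf) v u where "v \<in> V" "u \<in> V" "u \<noteq> v" "nbrs E V v = {u}" "v \<in> nbrs E V u"
proof -
  obtain v where v: "v \<in> V" "card (nbrs E V v) \<le> 1"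
    using assms by (auto simp: acyclic_on_def)
  show ?thesis
  proof (cases "nbrs E V v = {}")
    case False
    hence "card (nbrs E V v) = 1"
      using v assms(2) by (simp add: le_Suc_eq)
    then obtain u where u: "nbrs E V v = {u}" by (auto simp: card_1_singleton_iff)
    hence "u \<in> V" "(v, u) \<in> E" by (auto simp: nbrs_def)
    hence "u \<noteq> v" "v \<in> nbrs E V u" using E_irrefl E_sym v(1) by (auto simp: nbrs_def)
    thus ?thesis using leaf v u \<open>u \<in> V\<close> by blast
  qed (use isolated v in blast)
qed

lemma card_edges_less:
  assumes "finite V" "V \<noteq> {}" "acyclic_on E V"
  shows "card (edges_on E V) < card V"
  using assms
proof (induction "card V" arbitrary: V rule: less_induct)
  case less
  obtain v where v: "v \<in> V" "card (nbrs E V v) \<le> 1"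
    using less.prems by (auto simp: acyclic_on_def)
  have eq: "card (edges_on E V) = card (edges_on E (V - {v})) + card (nbrs E V v)"
    using less.prems v by (intro card_edges_remove)
  show ?case
  proof (cases "V - {v} = {}")
    case True
    hence "nbrs E V v = {}" using E_irrefl v by (auto simp: nbrs_def)
    thus ?thesis using eq True v less.prems by (simp add: edges_on_def card_gt_0_iff)
  next
    case False
    have "card (V - {v}) < card V" using less.prems v by (intro card_Diff1_less)
    hence "card (edges_on E (V - {v})) < card (V - {v})"
      using less.hyps[of "V - {v}"] less.prems False by (auto intro: acyclic_on_subset)
    thus ?thesis using eq v less.prems by simp
  qed
qed

lemma rtrancl_on_sym_iff: "(a, b) \<in> rtrancl_on V E \<longleftrightarrow> (b, a) \<in> rtrancl_on V E"
  using rtrancl_on_sym[OF sym_E] by (auto dest: symD)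

lemma component_eq_iff:
  assumes "a \<in> V" "b \<in> V"
  shows "{c. (a, c) \<in> rtrancl_on V E} = {c. (b, c) \<in> rtrancl_on V E} \<longleftrightarrow> (a, b) \<in> rtrancl_on V E"
proof
  assume "{c. (a, c) \<in> rtrancl_on V E} = {c. (b, c) \<in> rtrancl_on V E}"
  moreover have "(b, b) \<in> rtrancl_on V E" using assms by simp
  ultimately show "(a, b) \<in> rtrancl_on V E" by blast
next
  assume "(a, b) \<in> rtrancl_on V E"
  moreover have "(b, a) \<in> rtrancl_on V E" using calculation rtrancl_on_sym_iff by blast
  ultimately show "{c. (a, c) \<in> rtrancl_on V E} = {c. (b, c) \<in> rtrancl_on V E}"
    by (auto intro: rtrancl_on_trans)
qed

lemma rtrancl_on_isolated:
  assumes "(a, b) \<in> rtrancl_on V E" "nbrs E V v = {}"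
  shows "a = b \<or> a \<noteq> v \<and> b \<noteq> v \<and> (a, b) \<in> rtrancl_on (V - {v}) E"
  using assms(1)
proof induction
  case (step y z)
  have "y \<noteq> v" "z \<noteq> v" using step assms(2) E_sym[of y z] by (auto simp: nbrs_def)
  thus ?case using step by (auto intro: converse_rtrancl_on_into_rtrancl_on)
qed simp

text \<open>Retracting the leaf v onto its neighbour u maps walks in V to walks avoiding v.\<close>

lemma rtrancl_on_leaf:
  assumes "(a, b) \<in> rtrancl_on V E" "nbrs E V v = {u}" "u \<noteq> v"
  shows "((if a = v then u else a), (if b = v then u else b)) \<in> rtrancl_on (V - {v}) E"
  using assms(1)
proof induction
  case base
  thus ?case using assms by (auto simp: nbrs_def)
next
  case (step y z)
  consider "y = v" | "z = v" "y \<noteq> v" | "y \<noteq> v" "z \<noteq> v" by blast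
  thus ?case
  proof cases
    case 1
    hence "z = u" using step assms(2) by (auto simp: nbrs_def)
    thus ?thesis using step 1 assms(3) by simp
  next
    case 2
    hence "y \<in> nbrs E V v" using step E_sym[of y z] by (auto simp: nbrs_def)
    hence "y = u" using assms(2) by simp
    thus ?thesis using step 2 by simp
  next
    case 3
    thus ?thesis using step by (auto intro!: converse_rtrancl_on_into_rtrancl_on[of y z])
  qed
qed

text \<open>An isolated vertex is a component of its own. Deleting a leaf removes one edge and,
  thanks to the retraction onto its neighbour, neither merges nor splits the other classes.\<close>

lemma card_components:
  assumes "finite V" "acyclic_on E V"
  shows "card (components_on E V) + card (edges_on E V) = card V"
  using assms
proof (induction "card V" arbitrary: V rule: less_induct)
  case (less V)
  show ?case
  proof (cases "V = {}")
    case True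
    thus ?thesis by (simp add: components_on_def edges_on_def)
  next
    case ne: False
    let ?cl = "\<lambda>a. {b. (a, b) \<in> rtrancl_on V E}"
    have IH: "card (components_on E (V - {v})) + card (edges_on E (V - {v})) = card V - 1" if "v \<in> V" for v
      using less.hyps[of "V - {v}"] less.prems that card_Diff1_less[of V v]
      by (auto intro: acyclic_on_subset)
    have card_pos: "card V > 0" using ne less.prems by (simp add: card_gt_0_iff)
    have same: "card (?cl ` (V - {v})) = card (components_on E (V - {v}))"
      if *: "\<And>a b. a \<in> V - {v} \<Longrightarrow> b \<in> V - {v} \<Longrightarrow> (a, b) \<in> rtrancl_on V E \<Longrightarrow> (a, b) \<in> rtrancl_on (V - {v}) E" for v
      unfolding components_on_def
    proof (rule card_image_eq_if_same_fibres)
      fix a b assume ab: "a \<in> V - {v}" "b \<in> V - {v}"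
      have "(a, b) \<in> rtrancl_on V E \<longleftrightarrow> (a, b) \<in> rtrancl_on (V - {v}) E"
        using * ab rtrancl_on_mono[of E E "V - {v}" V a b] by blast
      thus "?cl a = ?cl b \<longleftrightarrow> {c. (a, c) \<in> rtrancl_on (V - {v}) E} = {c. (b, c) \<in> rtrancl_on (V - {v}) E}"
        using component_eq_iff[of a V b] component_eq_iff[of a "V - {v}" b] ab by simp
    qed
    from less.prems(2,1) ne show ?thesis
    proof (cases rule: acyclic_on_cases)
      case (isolated v)
      have "?cl v \<notin> ?cl ` (V - {v})"
      proof
        assume "?cl v \<in> ?cl ` (V - {v})"
        then obtain a where "a \<in> V - {v}" "?cl v = ?cl a" by blast
        thus False using component_eq_iff[of v V a] isolated rtrancl_on_isolated[of v a V v] by auto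
      qed
      moreover have "components_on E V = insert (?cl v) (?cl ` (V - {v}))"
        using isolated(1) by (auto simp: components_on_def)
      moreover have "card (?cl ` (V - {v})) = card (components_on E (V - {v}))"
        by (rule same) (use isolated rtrancl_on_isolated in fastforce)
      ultimately show ?thesis
        using IH[OF isolated(1)] card_edges_remove[OF less.prems(1) isolated(1)] isolated(2)
          less.prems(1) card_pos by simp
    next
      case (leaf v u)
      have "(v, u) \<in> rtrancl_on V E"
        using leaf rtrancl_on_into_rtrancl_on[of v v V E u] by (auto simp: nbrs_def)
      hence "?cl v = ?cl u" using component_eq_iff[of v V u] leaf by simp
      hence "components_on E V = ?cl ` (V - {v})"
        using leaf(1-3) by (auto simp: components_on_def)
      moreover have "card (?cl ` (V - {v})) = card (components_on E (V - {v}))"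
      proof (rule same)
        fix a b assume "a \<in> V - {v}" "b \<in> V - {v}" "(a, b) \<in> rtrancl_on V E"
        thus "(a, b) \<in> rtrancl_on (V - {v}) E" using rtrancl_on_leaf[OF _ leaf(4,3), of a b] by auto
      qed
      ultimately show ?thesis
        using IH[OF leaf(1)] card_edges_remove[OF less.prems(1) leaf(1)] leaf(4) card_pos by simp
    qed
  qed
qed

lemma graph_det_isolated:
  assumes "finite V" "v \<in> V" "nbrs E V v = {}"
  shows "graph_det E c V = graph_det E c (V - {v})"
  unfolding graph_det_def using assms
  by (subst set_det_isolated[of V v]) (auto simp: nbrs_def)

lemma graph_det_leaf:
  assumes "finite V" "v \<in> V" "nbrs E V v = {u}"
  shows "graph_det E c V = graph_det E c (V - {v}) - c\<^sup>2 * graph_det E c (V - {v, u})"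
proof -
  have u: "u \<in> V" "(v, u) \<in> E" "(u, v) \<in> E" using assms(3) E_sym[of v u] by (auto simp: nbrs_def)
  hence "u \<noteq> v" using E_irrefl by auto
  have no: "(v, w) \<notin> E" "(w, v) \<notin> E" if "w \<in> V" "w \<noteq> u" for w
    using assms(3) that E_sym[of w v] by (auto simp: nbrs_def)
  let ?A = "\<lambda>u v. if u = v then 1 else if (u, v) \<in> E then c else 0"
  have "set_det V ?A = ?A v v * set_det (V - {v}) ?A - ?A v u * ?A u v * set_det (V - {v, u}) ?A"
    by (rule set_det_leaf[OF assms(1,2) u(1) \<open>u \<noteq> v\<close>]) (simp_all add: no)
  thus ?thesis
    unfolding graph_det_def using u \<open>u \<noteq> v\<close> by (simp add: power2_eq_square)
qed

lemma graph_det_leaf_imaginary: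
  assumes "finite V" "v \<in> V" "nbrs E V v = {u}"
  shows "graph_det E (\<i> * of_real x) V =
    graph_det E (\<i> * of_real x) (V - {v}) + of_real (x\<^sup>2) * graph_det E (\<i> * of_real x) (V - {v, u})"
  using graph_det_leaf[OF assms, of "\<i> * of_real x"] by (simp add: power_mult_distrib)

text \<open>Once \<open>v\<close> is deleted, \<open>u\<close> is isolated, so both terms of the
  leaf expansion contain the same determinant.\<close>

lemma graph_det_edge_component:
  assumes "finite V" "v \<in> V" "u \<in> V" "u \<noteq> v" "nbrs E V v = {u}" "nbrs E V u = {v}"
  shows "graph_det E (\<i> * of_real x) V = of_real (1 + x\<^sup>2) * graph_det E (\<i> * of_real x) (V - {v, u})"
proof -
  have Diff: "V - {v} - {u} = V - {v, u}" by auto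
  have "graph_det E (\<i> * of_real x) (V - {v}) = graph_det E (\<i> * of_real x) (V - {v, u})"
    using assms graph_det_isolated[of "V - {v}" u] unfolding Diff by (simp add: nbrs_Diff)
  thus ?thesis using graph_det_leaf_imaginary[OF assms(1,2,5), of x] by (simp add: algebra_simps)
qed

lemma leaf_remove_edges:
  assumes "finite V" "v \<in> V" "u \<in> V" "u \<noteq> v" "nbrs E V v = {u}" "v \<in> nbrs E V u"
  shows "card (edges_on E V) = card (edges_on E (V - {v})) + 1"
    and "card (edges_on E V) = card (edges_on E (V - {v, u})) + card (nbrs E V u)"
proof -
  show 1: "card (edges_on E V) = card (edges_on E (V - {v})) + 1"
    using card_edges_remove[OF assms(1,2)] assms(5) by simp
  have "card (edges_on E (V - {v})) = card (edges_on E (V - {v} - {u})) + card (nbrs E (V - {v}) u)"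
    using assms by (intro card_edges_remove) auto
  moreover have "card (nbrs E V u) > 0" using assms by (auto simp: card_gt_0_iff)
  ultimately show "card (edges_on E V) = card (edges_on E (V - {v, u})) + card (nbrs E V u)"
    using 1 assms by (simp add: nbrs_Diff Diff_insert2[symmetric] insert_commute)
qed

end

section \<open>The determinant of a forest\<close>

context simple_graph
begin

lemma forest_det_bounds:
  assumes "finite V" "V \<noteq> {}" "acyclic_on E V" "x > 0"
  shows "Im (graph_det E (\<i> * of_real x) V) = 0 \<and> 0 < Re (graph_det E (\<i> * of_real x) V) \<and>
    Re (graph_det E (\<i> * of_real x) V) \<le> extremal (x\<^sup>2) (card V) (card (edges_on E V))"
  using assms(1-3)
proof (induction "card V" arbitrary: V rule: less_induct)
  case (less V)
  let ?D = "graph_det E (\<i> * of_real x)" and ?e = "\<lambda>V. card (edges_on E V)" and ?t = "x\<^sup>2"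
  have t: "?t > 0" using assms(4) by simp
  have IH: "Im (?D (V - W)) = 0 \<and> 0 < Re (?D (V - W)) \<and> Re (?D (V - W)) \<le> extremal ?t (card (V - W)) (?e (V - W))"
    "?e (V - W) < card (V - W)"
    if "W \<subseteq> V" "W \<noteq> {}" "V - W \<noteq> {}" for W
  proof -
    have "card (V - W) < card V" using that less.prems by (intro psubset_card_mono) auto
    moreover have "acyclic_on E (V - W)" using less.prems acyclic_on_subset[of E V "V - W"] by auto
    ultimately show "Im (?D (V - W)) = 0 \<and> 0 < Re (?D (V - W)) \<and> Re (?D (V - W)) \<le> extremal ?t (card (V - W)) (?e (V - W))"
      "?e (V - W) < card (V - W)"
      using less.hyps[of "V - W"] card_edges_less[of "V - W"] less.prems that by auto
  qed
  from less.prems(3,1,2) show ?case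
  proof (cases rule: acyclic_on_cases)
    case (isolated v)
    have D: "?D V = ?D (V - {v})" using graph_det_isolated less.prems isolated by blast
    have e: "?e V = ?e (V - {v})" using card_edges_remove[OF less.prems(1) isolated(1)] isolated by simp
    show ?thesis
    proof (cases "V - {v} = {}")
      case True
      hence "V = {v}" using isolated by auto
      thus ?thesis using D e by (simp add: graph_det_def edges_on_def extremal_def)
    next
      case False
      hence "Suc (?e V) < card V" using IH(2)[of "{v}"] isolated e less.prems(1) by simp
      hence "extremal ?t (card V - 1) (?e V) \<le> extremal ?t (card V) (?e V)"
        by (rule extremal_add_vertex_le[OF t])
      thus ?thesis using IH(1)[of "{v}"] False isolated D e less.prems(1) by simp
    qed
  next
    case (leaf v u)
    have D: "?D V = ?D (V - {v}) + of_real ?t * ?D (V - {v, u})"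
      using graph_det_leaf_imaginary[of V v u x] less.prems leaf by auto
    note e = leaf_remove_edges[OF less.prems(1) leaf]
    have vu: "V - {v} \<noteq> {}" "{v, u} \<subseteq> V" using leaf by auto
    have c: "card (V - {v}) = card V - 1" "card (V - {v, u}) = card V - 2"
      using less.prems(1) leaf by (auto simp: card_Diff_subset)
    show ?thesis
    proof (cases "card (nbrs E V u) = 1")
      case True
      hence nu: "nbrs E V u = {v}" using leaf(5) by (auto simp: card_1_singleton_iff)
      have D': "?D V = of_real (1 + ?t) * ?D (V - {v, u})"
        by (rule graph_det_edge_component[OF less.prems(1) leaf(1-4) nu])
      show ?thesis
      proof (cases "V - {v, u} = {}")
        case empty: True
        hence V: "V = {v, u}" using vu by auto
        have "?D V = of_real (1 + ?t)" using D' empty by (simp add: graph_det_def)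
        moreover have "?e V = 1" using e(2) True empty by (simp add: edges_on_def)
        moreover have "card V = 2" using V leaf by simp
        moreover have "0 < 1 + ?t" using t by linarith
        ultimately show ?thesis by (simp add: extremal_def)
      next
        case False
        note ih = IH[OF vu(2) _ False]
        have "(1 + ?t) * extremal ?t (card V - 2) (?e V - 1) = extremal ?t (card V) (?e V)"
          using ih(2) e(2) True c by (intro extremal_add_edge_component[OF t]) auto
        moreover have "(1 + ?t) * Re (?D (V - {v, u})) \<le> (1 + ?t) * extremal ?t (card V - 2) (?e V - 1)"
          using ih(1) t e(2) True c by (intro mult_left_mono) auto
        ultimately show ?thesis unfolding D' using ih(1) t by (simp add: add_pos_pos)
      qed
    next
      case False
      hence d: "card (nbrs E V u) \<ge> 2"
        using leaf(5) less.prems(1) by (metis One_nat_def card_0_eq empty_iff finite_nbrs le_neq_implies_less less_2_cases linorder_not_le not_less_eq_eq)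
      have "V - {v, u} \<noteq> {}"
      proof
        assume "V - {v, u} = {}"
        hence "nbrs E V u \<subseteq> {v}" using E_irrefl by (auto simp: nbrs_def)
        hence "card (nbrs E V u) \<le> 1" using card_mono[of "{v}"] by simp
        thus False using d by simp
      qed
      note ih = IH[OF vu(2) _ this] and ihv = IH[of "{v}", OF _ _ vu(1)]
      have lt: "?e V < card V" using ihv(2) e(1) c leaf by auto
      have e2: "2 \<le> ?e V" using e(2) d by simp
      \<comment> \<open>A larger degree of \<open>u\<close> only removes more edges, and the bound
        grows strictly with the number of edges.\<close>
      have le2: "Re (?D (V - {v, u})) \<le> extremal ?t (card V - 2) (?e V - 2)"
      proof (cases "card (nbrs E V u) = 2")
        case True
        thus ?thesis using ih(1) e(2) c by simp
      next
        case False
        hence "extremal ?t (card V - 2) (?e (V - {v, u})) < extremal ?t (card V - 2) (?e V - 2)"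
          using d e(2) lt e2 by (intro extremal_strict_mono_edges[OF t]) auto
        thus ?thesis using ih(1) c by simp
      qed
      have "Re (?D V) \<le> extremal ?t (card V - 1) (?e V - 1) + ?t * extremal ?t (card V - 2) (?e V - 2)"
        unfolding D using ihv(1) le2 t leaf c e(1) by (auto intro!: add_mono mult_left_mono)
      also have "\<dots> \<le> extremal ?t (card V) (?e V)"
        using extremal_rec[OF t lt] extremal_rec_less[OF t e2, of "card V"] by (cases "card V < 2 * ?e V") auto
      finally show ?thesis
        unfolding D using ihv(1) ih(1) t leaf by (auto intro!: add_pos_pos mult_pos_pos)
    qed
  qed
qed

end

section \<open>Coordinates and symmetries of the path forest\<close>

lemma path_forest_verts:
  "(i, a) \<in> pverts (path_forest n k) \<longleftrightarrow> i < k \<and> a < (if i < k - 1 then 2 else n - 2 * k + 2)"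
  by (auto simp: path_forest_def disjoint_union_def path_graph_def)

lemma path_forest_arcs:
  "((i, a), (j, b)) \<in> parcs (path_forest n k) \<longleftrightarrow>
     (i, a) \<in> pverts (path_forest n k) \<and> (j, b) \<in> pverts (path_forest n k) \<and> j = i \<and> (b = Suc a \<or> a = Suc b)"
  by (auto simp: path_forest_def disjoint_union_def path_graph_def)

definition iso_on :: "'a rel \<Rightarrow> 'a set \<Rightarrow> 'b pair_pre_digraph \<Rightarrow> ('a \<Rightarrow> 'b) \<Rightarrow> bool" where
  "iso_on E V H f \<longleftrightarrow> bij_betw f V (pverts H) \<and> (\<forall>a\<in>V. \<forall>b\<in>V. (a, b) \<in> E \<longleftrightarrow> (f a, f b) \<in> parcs H)"

lemma iso_on_comp:
  assumes "iso_on E V H f" "iso_on (parcs H) (pverts H) K g"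
  shows "iso_on E V K (g \<circ> f)"
  unfolding iso_on_def
proof (intro conjI ballI)
  show "bij_betw (g \<circ> f) V (pverts K)"
    using assms bij_betw_trans by (auto simp: iso_on_def)
  fix a b assume "a \<in> V" "b \<in> V"
  moreover from this have "f a \<in> pverts H" "f b \<in> pverts H"
    using assms(1) by (auto simp: iso_on_def dest: bij_betwE)
  ultimately show "(a, b) \<in> E \<longleftrightarrow> ((g \<circ> f) a, (g \<circ> f) b) \<in> parcs K"
    using assms unfolding iso_on_def o_def by blast
qed

text \<open>For n = 2 k the last path is a P_2 too, so it can change places with any other
  component.\<close>

lemma path_forest_swap:
  assumes "i < k"
  shows "iso_on (parcs (path_forest (2 * k) k)) (pverts (path_forest (2 * k) k)) (path_forest (2 * k) k)
    (\<lambda>(j, a). (Transposition.transpose i (k - 1) j, a))"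
proof -
  let ?g = "\<lambda>(j, a). (Transposition.transpose i (k - 1) j, a) :: nat \<times> nat"
  have V: "pverts (path_forest (2 * k) k) = {..<k} \<times> {..<2}"
    by (auto simp: path_forest_verts split: if_splits)
  have lt: "Transposition.transpose i (k - 1) j < k \<longleftrightarrow> j < k" for j
    using assms by (auto simp: Transposition.transpose_def split: if_splits)
  have eq: "Transposition.transpose i (k - 1) j = Transposition.transpose i (k - 1) j' \<longleftrightarrow> j = j'" for j j'
    by (rule inj_eq) (rule inj_transpose)
  have "?g p \<in> {..<k} \<times> {..<2} \<and> ?g (?g p) = p" if "p \<in> {..<k} \<times> {..<2}" for p
    using that by (cases p) (simp add: lt del: One_nat_def)
  hence "bij_betw ?g ({..<k} \<times> {..<2}) ({..<k} \<times> {..<2})"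
    by (intro bij_betwI[of _ _ _ ?g]) blast+
  moreover have "(p, q) \<in> parcs (path_forest (2 * k) k) \<longleftrightarrow> (?g p, ?g q) \<in> parcs (path_forest (2 * k) k)" for p q
    by (cases p; cases q) (simp add: path_forest_arcs V lt eq del: One_nat_def)
  ultimately show ?thesis unfolding iso_on_def V by blast
qed

lemma path_forest_reverse:
  assumes "k \<ge> 1"
  shows "iso_on (parcs (path_forest n k)) (pverts (path_forest n k)) (path_forest n k)
    (\<lambda>(j, a). (j, if j = k - 1 then n - 2 * k + 1 - a else a))"
proof -
  let ?g = "\<lambda>(j, a). (j, if j = k - 1 then n - 2 * k + 1 - a else a) :: nat \<times> nat"
  have "bij_betw ?g (pverts (path_forest n k)) (pverts (path_forest n k))"
    by (intro bij_betwI[of _ _ _ ?g]) (auto simp: path_forest_verts split: if_splits)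
  thus ?thesis
    by (auto simp: iso_on_def path_forest_arcs path_forest_verts split: if_splits)
qed

section \<open>Extension of isomorphisms and reconstruction of the extremal forest\<close>

context simple_graph
begin

text \<open>The new P_2 receives index 0 and the others are shifted by \<open>Suc\<close>, which
  keeps the long path last. Its length is unchanged, since n - 2 - 2 (k - 1) = n - 2 k.\<close>

lemma iso_on_add_edge:
  assumes f: "iso_on E (V - {v, u}) (path_forest (n - 2) (k - 1)) f"
    and V: "v \<in> V" "u \<in> V" "u \<noteq> v" "nbrs E V v = {u}" "nbrs E V u = {v}"
    and k: "k \<ge> 2"
  shows "iso_on E V (path_forest n k)
    (\<lambda>a. if a = v then (0, 0) else if a = u then (0, 1) else map_prod Suc id (f a))" (is "iso_on _ _ _ ?g")
proof -
  let ?P = "path_forest (n - 2) (k - 1)" and ?Q = "path_forest n k"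
  have verts: "pverts ?Q = insert (0, 0) (insert (0, 1) (map_prod Suc id ` pverts ?P))"
  proof (intro equalityI subsetI)
    fix p assume p: "p \<in> pverts ?Q"
    obtain i a where ia: "p = (i, a)" by (cases p)
    show "p \<in> insert (0, 0) (insert (0, 1) (map_prod Suc id ` pverts ?P))"
    proof (cases i)
      case 0
      thus ?thesis using p k ia by (auto simp: path_forest_verts)
    next
      case (Suc j)
      hence "(j, a) \<in> pverts ?P" using p k ia by (auto simp: path_forest_verts split: if_splits)
      moreover have "p = map_prod Suc id (j, a)" using ia Suc by simp
      ultimately show ?thesis by blast
    qed
  qed (use k in \<open>auto simp: path_forest_verts split: if_splits\<close>)
  have bij: "bij_betw f (V - {v, u}) (pverts ?P)"
    and adj: "\<And>a b. a \<in> V - {v, u} \<Longrightarrow> b \<in> V - {v, u} \<Longrightarrow> (a, b) \<in> E \<longleftrightarrow> (f a, f b) \<in> parcs ?P"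
    using f by (auto simp: iso_on_def)
  have "inj_on ?g V"
  proof (rule inj_onI)
    fix a b assume ab: "a \<in> V" "b \<in> V" "?g a = ?g b"
    have ms: "map_prod Suc id p \<noteq> (0, c)" "(0, c) \<noteq> map_prod Suc id p"
      "map_prod Suc id p = map_prod Suc id q \<longleftrightarrow> p = q" for p q :: "nat \<times> nat" and c
      by (cases p; cases q; simp)+
    have "f a = f b \<Longrightarrow> a = b" if "a \<in> V - {v, u}" "b \<in> V - {v, u}"
      using that bij by (auto simp: bij_betw_def dest: inj_onD)
    thus "a = b" using ab by (simp add: ms split: if_splits)
  qed
  moreover have "?g ` V = pverts ?Q"
  proof -
    have "V = insert v (insert u (V - {v, u}))" using V by auto
    hence "?g ` V = insert (0, 0) (insert (0, 1) (?g ` (V - {v, u})))" using V(3) by (smt (verit, best) image_insert)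
    also have "?g ` (V - {v, u}) = map_prod Suc id ` (f ` (V - {v, u}))" by (auto simp: image_image)
    finally show ?thesis using bij verts by (simp add: bij_betw_def)
  qed
  moreover have "(a, b) \<in> E \<longleftrightarrow> (?g a, ?g b) \<in> parcs ?Q" if ab: "a \<in> V" "b \<in> V" for a b
  proof -
    have v: "(v, w) \<in> E \<longleftrightarrow> w = u" "(w, v) \<in> E \<longleftrightarrow> w = u" if "w \<in> V" for w
      using V(2,4) that E_sym[of w v] by (auto simp: nbrs_def)
    have u: "(u, w) \<in> E \<longleftrightarrow> w = v" "(w, u) \<in> E \<longleftrightarrow> w = v" if "w \<in> V" for w
      using V(1,5) that E_sym[of w u] by (auto simp: nbrs_def)
    have mem: "f w \<in> pverts ?P" if "w \<in> V" "w \<noteq> v" "w \<noteq> u" for w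
      using bij that by (auto simp: bij_betw_def)
    have shift: "(map_prod Suc id p, map_prod Suc id q) \<in> parcs ?Q \<longleftrightarrow> (p, q) \<in> parcs ?P" for p q
      using k by (cases p; cases q) (auto simp: path_forest_arcs path_forest_verts split: if_splits)
    have no: "((0, c), map_prod Suc id p) \<notin> parcs ?Q" "(map_prod Suc id p, (0, c)) \<notin> parcs ?Q" for c p
      by (cases p; simp add: path_forest_arcs)+
    have 01: "((0, 0), (0, 1)) \<in> parcs ?Q" "((0, 1), (0, 0)) \<in> parcs ?Q"
      "((0, 0), (0, 0)) \<notin> parcs ?Q" "((0, 1), (0, 1)) \<notin> parcs ?Q"
      using k by (auto simp: path_forest_arcs path_forest_verts)
    consider "a = v" | "a = u" | "a \<noteq> v" "a \<noteq> u" by blast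
    thus ?thesis
      by cases (use ab V(3) v u adj shift no 01 in \<open>auto simp del: One_nat_def\<close>)
  qed
  ultimately show ?thesis by (simp add: iso_on_def bij_betw_def)
qed

text \<open>The assumption on \<open>f u\<close> places \<open>u\<close> at the far end of the long
  path of the smaller forest, whose positions end at n - 2 k; \<open>v\<close> takes the next
  position.\<close>

lemma iso_on_extend_path:
  assumes f: "iso_on E (V - {v}) (path_forest (n - 1) k) f"
    and V: "v \<in> V" "u \<in> V" "u \<noteq> v" "nbrs E V v = {u}"
    and k: "k \<ge> 1" "2 * k < n" and fu: "f u = (k - 1, n - 2 * k)"
  shows "iso_on E V (path_forest n k) (f(v := (k - 1, n - 2 * k + 1)))" (is "iso_on _ _ _ ?g")
proof -
  let ?P = "path_forest (n - 1) k" and ?Q = "path_forest n k"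
  have verts: "pverts ?Q = insert (k - 1, n - 2 * k + 1) (pverts ?P)"
    using k by (auto simp: path_forest_verts split: if_splits)
  have new: "(k - 1, n - 2 * k + 1) \<notin> pverts ?P" using k by (auto simp: path_forest_verts)
  have bij: "bij_betw f (V - {v}) (pverts ?P)"
    and adj: "\<And>a b. a \<in> V - {v} \<Longrightarrow> b \<in> V - {v} \<Longrightarrow> (a, b) \<in> E \<longleftrightarrow> (f a, f b) \<in> parcs ?P"
    using f by (auto simp: iso_on_def)
  have mem: "f w \<in> pverts ?P" if "w \<in> V" "w \<noteq> v" for w
    using bij that by (auto simp: bij_betw_def)
  have "bij_betw ?g (V - {v}) (pverts ?P)"
    using bij by (subst bij_betw_cong[of _ _ f]) auto
  hence "bij_betw ?g ((V - {v}) \<union> {v}) (pverts ?P \<union> {?g v})"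
    using new by (intro notIn_Un_bij_betw) auto
  hence "bij_betw ?g V (pverts ?Q)" using V(1) by (simp add: verts insert_absorb)
  moreover have "(a, b) \<in> E \<longleftrightarrow> (?g a, ?g b) \<in> parcs ?Q" if ab: "a \<in> V" "b \<in> V" for a b
  proof -
    have v: "(v, w) \<in> E \<longleftrightarrow> w = u" "(w, v) \<in> E \<longleftrightarrow> w = u" if "w \<in> V" for w
      using V(2,4) that E_sym[of w v] by (auto simp: nbrs_def)
    have inj: "f w = f u \<longleftrightarrow> w = u" if "w \<in> V" "w \<noteq> v" for w
      using bij that V by (auto simp: bij_betw_def inj_on_def)
    have old: "(p, q) \<in> parcs ?Q \<longleftrightarrow> (p, q) \<in> parcs ?P" if "p \<in> pverts ?P" "q \<in> pverts ?P" for p q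
      using that by (cases p; cases q) (auto simp: path_forest_arcs verts)
    have last: "(p, (k - 1, n - 2 * k + 1)) \<in> parcs ?Q \<longleftrightarrow> p = f u"
      "((k - 1, n - 2 * k + 1), p) \<in> parcs ?Q \<longleftrightarrow> p = f u" if "p \<in> pverts ?P" for p
      using that k unfolding fu by (cases p; auto simp: path_forest_arcs path_forest_verts split: if_splits)+
    have irr: "((k - 1, n - 2 * k + 1), (k - 1, n - 2 * k + 1)) \<notin> parcs ?Q"
      by (simp add: path_forest_arcs)
    show ?thesis
      using ab v adj mem inj old last irr E_irrefl by (cases "a = v"; cases "b = v") auto
  qed
  ultimately show ?thesis by (simp add: iso_on_def)
qed

text \<open>A vertex of the long path with at most one neighbour is an end of it, and reflection can
  make it the far end. If all components are P_2, an exchange brings the vertex into the last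
  one.\<close>

lemma iso_on_end_normalize:
  assumes f: "iso_on E V (path_forest n k) f" and u: "u \<in> V" "f u = (i, a)"
    and deg: "finite V" "card (nbrs E V u) \<le> 1"
    and k: "k \<ge> 1" "2 * k \<le> n" "i = k - 1 \<or> n = 2 * k"
  shows "\<exists>g. iso_on E V (path_forest n k) g \<and> g u = (k - 1, n - 2 * k + 1)"
proof -
  have bij: "bij_betw f V (pverts (path_forest n k))" using f by (simp add: iso_on_def)
  hence ia: "(i, a) \<in> pverts (path_forest n k)" using u by (metis bij_betwE)
  have "\<exists>h. iso_on E V (path_forest n k) h \<and> h u = (k - 1, a)"
  proof (cases "i = k - 1")
    case False
    hence n: "n = 2 * k" using k by simp
    have "iso_on E V (path_forest n k) ((\<lambda>(j, a). (Transposition.transpose i (k - 1) j, a)) \<circ> f)"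
      using iso_on_comp[OF f] path_forest_swap[of i k] ia unfolding n by (auto simp: path_forest_verts)
    thus ?thesis using u by (auto intro!: exI)
  qed (use f u in auto)
  then obtain h where h: "iso_on E V (path_forest n k) h" "h u = (k - 1, a)" by blast
  have bij: "bij_betw h V (pverts (path_forest n k))" using h by (simp add: iso_on_def)
  hence ka: "(k - 1, a) \<in> pverts (path_forest n k)" using u h by (metis bij_betwE)
  consider "a = n - 2 * k + 1" | "a = 0" | "0 < a" "a < n - 2 * k + 1"
    using ka k by (fastforce simp: path_forest_verts split: if_splits)
  thus ?thesis
  proof cases
    case 1
    thus ?thesis using h by auto
  next
    case 2
    thus ?thesis using iso_on_comp[OF h(1) path_forest_reverse[OF k(1)]] h(2) by (auto intro!: exI)
  next
    case 3
    let ?p = "(k - 1, a - 1)" and ?q = "(k - 1, a + 1)"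
    have pq: "?p \<in> pverts (path_forest n k)" "?q \<in> pverts (path_forest n k)"
      using 3 k by (auto simp: path_forest_verts)
    then obtain b c where b: "b \<in> V" "h b = ?p" and c: "c \<in> V" "h c = ?q"
      using bij by (metis bij_betw_imp_surj_on imageE)
    have "b \<in> nbrs E V u" "c \<in> nbrs E V u"
      using h b c u pq ka 3 by (auto simp: iso_on_def nbrs_def path_forest_arcs)
    moreover have "b \<noteq> c" using b c by auto
    ultimately have "card {b, c} \<le> card (nbrs E V u)" using deg(1) by (intro card_mono) auto
    thus ?thesis using deg(2) \<open>b \<noteq> c\<close> by simp
  qed
qed

text \<open>The weak inequality admits n = 2 e, the case of components P_2 only, to which the
  deletion of leaves leads down. Beyond it the extremal forest has isolated vertices and is no path
  forest.\<close>

theorem extremal_forest_iso: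
  assumes "finite V" "acyclic_on E V" "x > 0"
    and "card V \<le> 2 * card (edges_on E V)"
    and "Re (graph_det E (\<i> * of_real x) V) = extremal (x\<^sup>2) (card V) (card (edges_on E V))"
  shows "\<exists>f. iso_on E V (path_forest (card V) (card V - card (edges_on E V))) f"
  using assms(1,2,4,5)
proof (induction "card V" arbitrary: V rule: less_induct)
  case (less V)
  let ?D = "graph_det E (\<i> * of_real x)" and ?e = "\<lambda>V. card (edges_on E V)" and ?t = "x\<^sup>2"
  define n e where "n = card V" and "e = ?e V"
  have t: "?t > 0" using assms(3) by simp
  show ?case
  proof (cases "V = {}")
    case True
    thus ?thesis by (auto simp: iso_on_def bij_betw_def edges_on_def path_forest_def disjoint_union_def)
  next
    case False
    have lt: "e < n" unfolding n_def e_def by (rule card_edges_less[OF less.prems(1) False less.prems(2)])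
    have ne: "n \<le> 2 * e" and DV: "Re (?D V) = extremal ?t n e" using less.prems by (auto simp: n_def e_def)
    have acyc: "acyclic_on E (V - W)" for W
      using less.prems(2) acyclic_on_subset[of E V "V - W"] by auto
    have bound: "Re (?D (V - W)) \<le> extremal ?t (card (V - W)) (?e (V - W))" "?e (V - W) < card (V - W)"
      if "V - W \<noteq> {}" for W
      using forest_det_bounds[of "V - W"] card_edges_less[of "V - W"] less.prems(1) acyc that assms(3) by auto
    from less.prems(2,1) False show ?thesis
    proof (cases rule: acyclic_on_cases)
      case (isolated v)
      have D: "?D V = ?D (V - {v})" using graph_det_isolated less.prems isolated by blast
      have ev: "?e (V - {v}) = e"
        using card_edges_remove[OF less.prems(1) isolated(1)] isolated by (simp add: e_def)
      have cv: "card (V - {v}) = n - 1" using isolated less.prems(1) by (simp add: n_def)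
      have "V - {v} \<noteq> {}"
      proof
        assume "V - {v} = {}"
        moreover from this have "V = {v}" using isolated(1) by auto
        ultimately have "n = 1" "e = 0" using ev by (simp_all add: edges_on_def n_def)
        thus False using ne by simp
      qed
      note b = bound[OF this]
      \<comment> \<open>An isolated vertex would make the bound strict, against the assumed
        equality.\<close>
      have "extremal ?t (n - 1) e < extremal ?t n e"
        using b(2) ev cv ne by (intro extremal_add_vertex_less[OF t]) auto
      thus ?thesis using b(1) D DV ev cv by simp
    next
      case (leaf v u)
      have D: "?D V = ?D (V - {v}) + of_real ?t * ?D (V - {v, u})"
        using graph_det_leaf_imaginary[of V v u x] less.prems leaf by auto
      have ev: "?e (V - {v}) = e - 1" "e \<ge> 1" and evu: "?e (V - {v, u}) = e - card (nbrs E V u)" "card (nbrs E V u) \<le> e"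
        using leaf_remove_edges[OF less.prems(1) leaf] by (auto simp: e_def)
      have c: "card (V - {v}) = n - 1" "card (V - {v, u}) = n - 2" "n \<ge> 2"
        using less.prems(1) leaf card_mono[of V "{v, u}"] by (auto simp: card_Diff_subset n_def)
      have "V - {v} \<noteq> {}" using leaf by auto
      note bv = bound[OF this]
      show ?thesis
      proof (cases "card (nbrs E V u) = 1")
        case True
        hence nu: "nbrs E V u = {v}" using leaf(5) by (auto simp: card_1_singleton_iff)
        have D': "?D V = of_real (1 + ?t) * ?D (V - {v, u})"
          by (rule graph_det_edge_component[OF less.prems(1) leaf(1-4) nu])
        show ?thesis
        proof (cases "V - {v, u} = {}")
          case empty: True
          hence V: "V = {v, u}" using leaf by auto
          hence n: "n = 2" using leaf by (simp add: n_def)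
          hence e: "e = 1" using ne lt by simp
          have "iso_on E V (path_forest 2 1) (\<lambda>a. if a = v then (0, 0) else (0, 1))"
            unfolding iso_on_def V
          proof (intro conjI ballI)
            have "pverts (path_forest 2 1) = {(0, 0), (0, 1)}"
              by (auto simp: path_forest_verts split: if_splits)
            thus "bij_betw (\<lambda>a. if a = v then (0, 0) else (0, 1)) {v, u} (pverts (path_forest 2 1))"
              using leaf(3) by (auto simp: bij_betw_def)
            fix a b assume ab: "a \<in> {v, u}" "b \<in> {v, u}"
            have "(v, u) \<in> E" "(u, v) \<in> E" using leaf(4,5) by (auto simp: nbrs_def)
            thus "(a, b) \<in> E \<longleftrightarrow>
              ((if a = v then (0, 0) else (0, 1)), (if b = v then (0, 0) else (0, 1))) \<in> parcs (path_forest 2 1)"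
              using ab leaf(3) E_irrefl by (auto simp: path_forest_arcs path_forest_verts)
          qed
          thus ?thesis using n e by (auto simp: n_def[symmetric] e_def[symmetric])
        next
          case False
          note b = bound[OF False]
          have "(1 + ?t) * extremal ?t (n - 2) (e - 1) = extremal ?t n e"
            using b(2) evu c(2) True lt by (intro extremal_add_edge_component[OF t]) auto
          moreover have "Re (?D V) = (1 + ?t) * Re (?D (V - {v, u}))" unfolding D' by simp
          moreover have "1 + ?t > 0" using t by linarith
          ultimately have "Re (?D (V - {v, u})) = extremal ?t (n - 2) (e - 1)"
            using DV by (metis mult_left_cancel less_irrefl)
          moreover have "n - 2 \<le> 2 * (e - 1)" using ne by simp
          ultimately obtain f where "iso_on E (V - {v, u}) (path_forest (n - 2) (n - 2 - (e - 1))) f"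
            using less.hyps[of "V - {v, u}"] less.prems(1) acyc[of "{v, u}"] c evu True ne
            by (auto simp: n_def[symmetric])
          moreover have "n - 2 - (e - 1) = n - e - 1" using ev by simp
          moreover have "n - e \<ge> 2" using b(2) evu c True by simp
          ultimately show ?thesis
            using iso_on_add_edge[of V v u n "n - e" f] leaf nu by (auto simp: n_def[symmetric] e_def[symmetric])
        qed
      next
        case False
        have "card (nbrs E V u) > 0" using leaf(5) less.prems(1) by (auto simp: card_gt_0_iff)
        hence d: "card (nbrs E V u) \<ge> 2" using False by simp
        have "V - {v, u} \<noteq> {}"
        proof
          assume "V - {v, u} = {}"
          hence "nbrs E V u \<subseteq> {v}" using E_irrefl by (auto simp: nbrs_def)
          hence "card (nbrs E V u) \<le> 1" using card_mono[of "{v}"] by simp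
          thus False using d by simp
        qed
        note bvu = bound[OF this]
        have e2: "2 \<le> e" using evu(2) d by simp
        have strict: "Re (?D (V - {v, u})) < extremal ?t (n - 2) (e - 2)" if "card (nbrs E V u) \<noteq> 2"
        proof -
          have "extremal ?t (n - 2) (e - card (nbrs E V u)) < extremal ?t (n - 2) (e - 2)"
            using d evu lt e2 that by (intro extremal_strict_mono_edges[OF t]) auto
          thus ?thesis using bvu(1) c evu by simp
        qed
        have le2: "Re (?D (V - {v, u})) \<le> extremal ?t (n - 2) (e - 2)"
          using strict bvu(1) c evu by (cases "card (nbrs E V u) = 2") auto
        have le1: "Re (?D (V - {v})) \<le> extremal ?t (n - 1) (e - 1)" using bv(1) ev c by simp
        have sum: "Re (?D (V - {v})) + ?t * Re (?D (V - {v, u})) = extremal ?t n e"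
          using DV unfolding D by simp
        have tle: "?t * Re (?D (V - {v, u})) \<le> ?t * extremal ?t (n - 2) (e - 2)"
          using le2 t by (intro mult_left_mono) auto
        \<comment> \<open>At n = 2 e the two estimates would add up to strictly less than the
          assumed value.\<close>
        have ne': "n < 2 * e"
          using extremal_rec_less[OF t e2, of n] sum le1 tle by linarith
        note rec = extremal_rec[OF t lt ne']
        \<comment> \<open>The sum of the two upper bounds is attained, so each of them is.\<close>
        have D1: "Re (?D (V - {v})) = extremal ?t (n - 1) (e - 1)"
          and "?t * Re (?D (V - {v, u})) = ?t * extremal ?t (n - 2) (e - 2)"
          using rec sum le1 tle by linarith+
        hence D2: "Re (?D (V - {v, u})) = extremal ?t (n - 2) (e - 2)" using t by simp
        hence d2: "card (nbrs E V u) = 2" using strict by fastforce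
        define k where "k = n - e"
        have k: "k \<ge> 1" "2 * k < n" "n - 1 - (e - 1) = k" "e = n - k" using lt ne' ev by (auto simp: k_def)
        have "n - 1 \<le> 2 * (e - 1)" using ne' by simp
        then obtain f where f: "iso_on E (V - {v}) (path_forest (n - 1) k) f"
          using less.hyps[of "V - {v}"] less.prems(1) acyc[of "{v}"] c ev D1 ne' k(3)
          by (auto simp: n_def[symmetric])
        have bij: "bij_betw f (V - {v}) (pverts (path_forest (n - 1) k))" using f by (simp add: iso_on_def)
        have u: "u \<in> V - {v}" using leaf by simp
        obtain i a where fu: "f u = (i, a)" by (cases "f u")
        have fu_in: "(i, a) \<in> pverts (path_forest (n - 1) k)" using bij u fu by (metis bij_betwE)
        \<comment> \<open>Suppose that \<open>u\<close> lies in a P_2 beside a longer path. Its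
          partner \<open>w\<close> is isolated in \<open>V - {v, u}\<close>, and discarding
          \<open>w\<close> lowers the bound for this set strictly, which contradicts
          \<open>D2\<close>.\<close>
        have i: "i = k - 1 \<or> n - 1 = 2 * k"
        proof (rule ccontr)
          assume "\<not> (i = k - 1 \<or> n - 1 = 2 * k)"
          hence ik: "i < k - 1" and n: "2 * k + 2 \<le> n" using fu_in k by (auto simp: path_forest_verts)
          \<comment> \<open>\<open>1 - a\<close> exchanges the two positions 0 and 1 of a
            P_2.\<close>
          have "(i, 1 - a) \<in> pverts (path_forest (n - 1) k)" using ik by (auto simp: path_forest_verts)
          then obtain w where w: "w \<in> V - {v}" "f w = (i, 1 - a)" using bij by (metis bij_betw_imp_surj_on imageE)
          have "a < 2" using fu_in ik by (simp add: path_forest_verts)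
          hence "1 - a \<noteq> a" by arith
          hence wu: "w \<noteq> u" using w fu by auto
          have iso: "nbrs E (V - {v, u}) w = {}"
          proof -
            have "b = u" if b: "b \<in> V - {v}" "(w, b) \<in> E" for b
            proof -
              have "(f w, f b) \<in> parcs (path_forest (n - 1) k)" using f b w by (auto simp: iso_on_def)
              hence "f b = f u" using w fu ik \<open>a < 2\<close>
                by (cases "f b") (auto simp: path_forest_arcs path_forest_verts)
              thus ?thesis using bij b u by (auto simp: bij_betw_def dest: inj_onD)
            qed
            thus ?thesis by (auto simp: nbrs_def)
          qed
          have Diff: "V - {v, u} - {w} = V - {v, u, w}" by auto
          have w': "w \<in> V - {v, u}" using w wu by simp
          have Dw: "?D (V - {v, u}) = ?D (V - {v, u, w})"
            using graph_det_isolated[OF _ w' iso] less.prems(1) unfolding Diff by simp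
          have ew: "?e (V - {v, u, w}) = e - 2"
            using card_edges_remove[OF _ w'] less.prems(1) evu d2 iso unfolding Diff by simp
          have cw: "card (V - {v, u, w}) = n - 2 - 1"
            using w' less.prems(1) c(2) card_Diff_singleton[OF w'] unfolding Diff by simp
          have "V - {v, u, w} \<noteq> {}" using cw n k by (intro notI) simp
          note bw = bound[OF this]
          have "extremal ?t (n - 2 - 1) (e - 2) < extremal ?t (n - 2) (e - 2)"
            using bw(2) ew cw n k by (intro extremal_add_vertex_less[OF t]) auto
          thus False using bw(1) D2 Dw ew cw by simp
        qed
        have "card (nbrs E (V - {v}) u) \<le> 1"
          using d2 leaf(5) less.prems(1) by (simp add: nbrs_Diff)
        moreover have "2 * k \<le> n - 1" using k(2) by simp
        ultimately obtain g where g: "iso_on E (V - {v}) (path_forest (n - 1) k) g" "g u = (k - 1, n - 1 - 2 * k + 1)"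
          using iso_on_end_normalize[OF f u fu] less.prems(1) k i by auto
        have "n - 1 - 2 * k + 1 = n - 2 * k" using k by simp
        hence "\<exists>f. iso_on E V (path_forest n k) f"
          using iso_on_extend_path[OF g(1) leaf(1-4) k(1,2)] g(2) by auto
        thus ?thesis by (simp add: k_def n_def e_def)
      qed
    qed
  qed
qed

end

section \<open>The path forest and the library notions\<close>

lemma pair_graph_simple_graph: "pair_graph G \<Longrightarrow> simple_graph (parcs G)"
proof
  assume "pair_graph G"
  then interpret pair_graph G .
  show "sym (parcs G)" by (auto intro: symI arcs_symmetric)
  show "irrefl (parcs G)" using no_loops' by (auto simp: irrefl_def)
qed

lemma card_sccs_components:
  assumes "pair_graph G"
  shows "card (pre_digraph.sccs (with_proj G)) = card (components_on (parcs G) (pverts G))"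
proof -
  interpret pair_graph G by fact
  interpret simple_graph "parcs G" by (rule pair_graph_simple_graph) fact
  have "scc_of u = {v. (u, v) \<in> rtrancl_on (pverts G) (parcs G)}" for u
    unfolding scc_of_def reachable_def using rtrancl_on_sym_iff by auto
  hence "sccs_verts = components_on (parcs G) (pverts G)"
    unfolding sccs_verts_conv_scc_of components_on_def by simp
  thus ?thesis using card_sccs_verts by simp
qed

text \<open>\<open>zip (u # ws) ws\<close> is the list of arcs of the walk with vertex sequence
  \<open>u # ws\<close>.\<close>

lemma pcas_zip: "pcas u (zip (u # ws) ws) (last (u # ws))"
  by (induction ws arbitrary: u) auto

lemma pawalk_verts_zip: "pawalk_verts u (zip (u # ws) ws) = u # ws"
  by (induction ws arbitrary: u) auto

lemma set_zip_successively:
  "successively (\<lambda>a b. (a, b) \<in> E) (u # ws) \<Longrightarrow> set (zip (u # ws) ws) \<subseteq> E"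
  by (induction ws arbitrary: u) auto

lemma successively_pawalk_verts:
  "pcas u p v \<Longrightarrow> set p \<subseteq> E \<Longrightarrow> successively (\<lambda>a b. (a, b) \<in> E) (pawalk_verts u p) \<and>
    hd (pawalk_verts u p) = u \<and> last (pawalk_verts u p) = v \<and> length (pawalk_verts u p) = Suc (length p)"
proof (induction p arbitrary: u)
  case (Cons e p)
  hence "pcas (snd e) p v" "fst e = u" "e \<in> E" "set p \<subseteq> E" by auto
  note IH = Cons.IH[OF this(1,4)]
  have "pawalk_verts (snd e) p \<noteq> []" by (cases p) auto
  thus ?case using IH \<open>fst e = u\<close> \<open>e \<in> E\<close> by (auto simp: successively_Cons)
qed simp

text \<open>The predecessor and the successor in the cyclic order are distinct because of the
  length; at either end of the list the closing arc supplies one of them.\<close>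

lemma cyclic_list_two_nbrs:
  assumes "sym E" "distinct xs" "length xs \<ge> 3" "successively (\<lambda>a b. (a, b) \<in> E) xs"
    "(last xs, hd xs) \<in> E" "v \<in> set xs"
  shows "2 \<le> card (nbrs E (set xs) v)"
proof -
  have two: "2 \<le> card (nbrs E (set xs) v)"
    if "a \<noteq> b" "a \<in> set xs" "b \<in> set xs" "(v, a) \<in> E" "(v, b) \<in> E" for a b
  proof -
    have "{a, b} \<subseteq> nbrs E (set xs) v" using that by (auto simp: nbrs_def)
    hence "card {a, b} \<le> card (nbrs E (set xs) v)" by (intro card_mono) auto
    thus ?thesis using that(1) by simp
  qed
  have sym: "(b, a) \<in> E" if "(a, b) \<in> E" for a b using assms(1) that by (rule symD)
  obtain as bs where xs: "xs = as @ v # bs" using assms(6) by (auto simp: in_set_conv_decomp)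
  consider "as = []" | "bs = []" | "as \<noteq> []" "bs \<noteq> []" by blast
  thus ?thesis
  proof cases
    case 1
    then obtain b bs' where bs: "bs = b # bs'" "bs' \<noteq> []"
      using assms(3) xs by (cases bs; cases "tl bs") auto
    have "last bs' \<in> set bs'" using bs by simp
    thus ?thesis using assms(2,4,5) xs bs 1
      by (intro two[of b "last bs'"]) (auto simp: sym)
  next
    case 2
    then obtain as' a where as: "as = as' @ [a]" "as' \<noteq> []"
      using assms(3) xs by (cases as rule: rev_cases; cases "butlast as") auto
    have "hd as' \<in> set as'" using as by simp
    thus ?thesis using assms(2,4,5) xs as 2
      by (intro two[of a "hd as'"]) (auto simp: sym successively_append_iff)
  next
    case 3
    have "last as \<in> set as" "hd bs \<in> set bs" using 3 by auto
    moreover from this have "last as \<noteq> hd bs" using assms(2) xs by auto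
    ultimately show ?thesis using assms(2,4) xs 3
      by (intro two[of "last as" "hd bs"]) (auto simp: sym successively_append_iff successively_Cons)
  qed
qed

text \<open>The vertices of a cycle induce a graph of minimum degree two. Conversely, in a set with
  that property a longest path contains all neighbours of its first vertex, and a neighbour beyond
  the second vertex closes a cycle.\<close>

lemma undirected_forest_iff:
  assumes "pair_graph G"
  shows "undirected_forest G \<longleftrightarrow> acyclic_on (parcs G) (pverts G)"
proof -
  interpret pair_graph G by fact
  interpret simple_graph "parcs G" by (rule pair_graph_simple_graph) fact
  let ?E = "parcs G" and ?V = "pverts G"
  have fin: "finite ?V" by (rule pair_finite_verts)
  have wf: "a \<in> ?V" "b \<in> ?V" if "(a, b) \<in> ?E" for a b using that in_arcsD1 in_arcsD2 by auto
  have "\<not> acyclic_on ?E ?V" if "cycle p" "length p \<ge> 3" for p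
  proof -
    from that obtain u where u: "awalk u p u" "distinct (tl (pawalk_verts u p))" "p \<noteq> []"
      by (auto simp: cycle_def)
    define xs where "xs = tl (pawalk_verts u p)"
    have "pcas u p u" "set p \<subseteq> ?E" using u by (auto simp: awalk_def)
    note * = successively_pawalk_verts[OF this]
    have w: "pawalk_verts u p = u # xs" using * by (cases "pawalk_verts u p") (auto simp: xs_def)
    have len: "length xs \<ge> 3" using * w that by simp
    hence "xs \<noteq> []" by auto
    have suc: "successively (\<lambda>a b. (a, b) \<in> ?E) xs" "(u, hd xs) \<in> ?E" "last xs = u"
      using * \<open>xs \<noteq> []\<close> unfolding w by (auto simp: successively_Cons)
    have "2 \<le> card (nbrs ?E (set xs) v)" if "v \<in> set xs" for v
      using cyclic_list_two_nbrs[OF sym_E _ len suc(1) _ that] u suc by (simp add: xs_def)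
    moreover have "set xs \<subseteq> ?V"
      using u(1) w by (auto simp: awalk_conv)
    ultimately show ?thesis using \<open>xs \<noteq> []\<close> unfolding acyclic_on_def
      by (metis Suc_1 not_less_eq_eq set_empty)
  qed
  moreover have "\<exists>p. cycle p \<and> length p \<ge> 3" if "\<not> acyclic_on ?E ?V"
  proof -
    from that obtain U where U: "U \<subseteq> ?V" "U \<noteq> {}" "\<And>v. v \<in> U \<Longrightarrow> \<not> card (nbrs ?E U v) \<le> 1"
      by (auto simp: acyclic_on_def)
    have finU: "finite U" using U(1) fin by (rule finite_subset)
    define P where "P xs \<longleftrightarrow> xs \<noteq> [] \<and> distinct xs \<and> set xs \<subseteq> U \<and> successively (\<lambda>a b. (a, b) \<in> ?E) xs" for xs
    obtain v where "v \<in> U" using U by auto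
    hence 1: "P [v]" by (simp add: P_def)
    have 2: "\<forall>xs. P xs \<longrightarrow> length xs < Suc (card U)"
      using finU by (auto simp: P_def less_Suc_eq_le distinct_card[symmetric] intro: card_mono)
    from ex_has_greatest_nat[of P, OF 1 2]
    obtain xs where xs: "P xs" and "\<forall>ys. P ys \<longrightarrow> length ys \<le> length xs" by (elim exE conjE)
    hence max: "length ys \<le> length xs" if "P ys" for ys using that by simp
    obtain x ys where x: "xs = x # ys" using xs by (cases xs) (auto simp: P_def)
    have nb: "nbrs ?E U x \<subseteq> set ys"
    proof
      fix z assume z: "z \<in> nbrs ?E U x"
      hence zE: "(z, x) \<in> ?E" "z \<in> U" "z \<noteq> x" using E_sym[of x z] E_irrefl by (auto simp: nbrs_def)
      show "z \<in> set ys"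
      proof (rule ccontr)
        assume "z \<notin> set ys"
        hence "P (z # xs)" using xs zE by (auto simp: P_def x successively_Cons)
        thus False using max[of "z # xs"] by simp
      qed
    qed
    have card2: "\<not> card (nbrs ?E U x) \<le> 1" using U(3) xs by (auto simp: P_def x)
    have "ys \<noteq> []" using nb card2 by auto
    then obtain y q where y: "ys = y # q" by (cases ys) auto
    have "\<not> nbrs ?E U x \<subseteq> {y}" using card2 card_mono[of "{y}" "nbrs ?E U x"] by auto
    then obtain z where z: "z \<in> nbrs ?E U x" "z \<in> set q" using nb y by auto
    then obtain q1 q2 where q: "q = q1 @ z # q2" by (auto simp: in_set_conv_decomp)
    \<comment> \<open>The closed walk is x, y, q1, z, x. As \<open>z\<close> comes after
      \<open>y\<close>, it has at least three arcs and does not merely run back and forth along an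
      edge.\<close>
    define ws where "ws = y # q1 @ [z, x]"
    have zx: "(z, x) \<in> ?E" using z E_sym[of x z] by (simp add: nbrs_def)
    have suc: "successively (\<lambda>a b. (a, b) \<in> ?E) (x # ws)"
      using xs zx by (auto simp: P_def x y q ws_def successively_append_iff successively_Cons hd_append split: if_splits)
    let ?p = "zip (x # ws) ws"
    have "x \<in> ?V" using xs U(1) by (auto simp: P_def x)
    hence "awalk x ?p x"
      using set_zip_successively[OF suc] pcas_zip[of x ws] by (simp add: awalk_def ws_def)
    moreover have "distinct (tl (pawalk_verts x ?p))"
      using xs unfolding pawalk_verts_zip by (auto simp: P_def x y q ws_def)
    moreover have "length ?p \<ge> 3" by (simp add: ws_def)
    ultimately have "cycle ?p \<and> length ?p \<ge> 3" unfolding cycle_def by auto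
    thus ?thesis by blast
  qed
  ultimately show ?thesis using assms unfolding undirected_forest_def by blast
qed

text \<open>An arc is the pair of its ends, so the vertex map of an isomorphism determines its
  action on arcs.\<close>

lemma isomorphic_iff_iso_on:
  assumes "pair_graph G" "pair_graph H"
  shows "isomorphic G H \<longleftrightarrow> (\<exists>f. iso_on (parcs G) (pverts G) H f)"
proof
  interpret G: pair_graph G by fact
  assume "isomorphic G H"
  then obtain h where h: "G.digraph_isomorphism h" "with_proj H = app_iso h (with_proj G)"
    by (auto simp: isomorphic_def digraph_iso_def)
  let ?f = "iso_verts h"
  have 1: "pverts H = ?f ` pverts G" "parcs H = iso_arcs h ` parcs G" "iso_tail h = fst" "iso_head h = snd"
    using arg_cong[OF h(2), of verts] arg_cong[OF h(2), of arcs] arg_cong[OF h(2), of tail]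
      arg_cong[OF h(2), of head] by simp_all
  have inj: "inj_on ?f (pverts G)" using h(1) by (simp add: G.digraph_isomorphism_def)
  have "iso_arcs h (a, b) = (?f a, ?f b)" if "(a, b) \<in> parcs G" for a b
    using h(1) that 1 by (auto simp: G.digraph_isomorphism_def prod_eq_iff)
  hence "parcs H = (\<lambda>(a, b). (?f a, ?f b)) ` parcs G"
    unfolding 1(2) by (intro image_cong) auto
  moreover have "a \<in> pverts G" "b \<in> pverts G" if "(a, b) \<in> parcs G" for a b
    using that G.in_arcsD1 G.in_arcsD2 by auto
  ultimately have "(a, b) \<in> parcs G \<longleftrightarrow> (?f a, ?f b) \<in> parcs H" if "a \<in> pverts G" "b \<in> pverts G" for a b
    using that inj by (auto simp: inj_on_eq_iff)
  hence "iso_on (parcs G) (pverts G) H ?f" using 1(1) inj by (simp add: iso_on_def bij_betw_def)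
  thus "\<exists>f. iso_on (parcs G) (pverts G) H f" by blast
next
  interpret G: pair_graph G by fact
  interpret H: pair_graph H by fact
  assume "\<exists>f. iso_on (parcs G) (pverts G) H f"
  then obtain f where f: "bij_betw f (pverts G) (pverts H)"
    and adj: "\<And>a b. a \<in> pverts G \<Longrightarrow> b \<in> pverts G \<Longrightarrow> (a, b) \<in> parcs G \<longleftrightarrow> (f a, f b) \<in> parcs H"
    by (auto simp: iso_on_def)
  have wfG: "a \<in> pverts G" "b \<in> pverts G" if "(a, b) \<in> parcs G" for a b
    using that G.in_arcsD1 G.in_arcsD2 by auto
  have wfH: "a \<in> pverts H" "b \<in> pverts H" if "(a, b) \<in> parcs H" for a b
    using that H.in_arcsD1 H.in_arcsD2 by auto
  have inj: "inj_on f (pverts G)" and img: "pverts H = f ` pverts G" using f by (auto simp: bij_betw_def)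
  have arcs: "parcs H = (\<lambda>(a, b). (f a, f b)) ` parcs G"
  proof (intro equalityI subsetI)
    fix e assume e: "e \<in> parcs H"
    obtain c d where cd: "e = (c, d)" by (cases e)
    then obtain a b where "a \<in> pverts G" "b \<in> pverts G" "c = f a" "d = f b"
      using wfH[of c d] e img by blast
    thus "e \<in> (\<lambda>(a, b). (f a, f b)) ` parcs G" using e cd adj by force
  next
    fix e assume "e \<in> (\<lambda>(a, b). (f a, f b)) ` parcs G"
    then obtain a b where "(a, b) \<in> parcs G" "e = (f a, f b)" by auto
    thus "e \<in> parcs H" using adj wfG[of a b] by simp
  qed
  let ?h = "\<lparr>iso_verts = f, iso_arcs = (\<lambda>(a, b). (f a, f b)), iso_head = snd, iso_tail = fst\<rparr>"
  have "inj_on (\<lambda>(a, b). (f a, f b)) (parcs G)"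
    using wfG inj by (auto simp: inj_on_def)
  hence "G.digraph_isomorphism ?h"
    unfolding G.digraph_isomorphism_def using inj G.wf_digraph by auto
  moreover have "with_proj H = app_iso ?h (with_proj G)"
    by (simp add: with_proj_def app_iso_def img arcs)
  ultimately show "isomorphic G H" by (auto simp: isomorphic_def digraph_iso_def)
qed

section \<open>Size, acyclicity, edges and determinant of the path forest\<close>

lemma path_forest_verts_eq:
  assumes "k \<ge> 1"
  shows "pverts (path_forest n k) = {..<k - 1} \<times> {..<2} \<union> {k - 1} \<times> {..<n - 2 * k + 2}"
  using assms by (auto simp: path_forest_verts split: if_splits)

lemma path_forest_pair_graph:
  assumes "k \<ge> 1" shows "pair_graph (path_forest n k)"
proof -
  let ?V = "pverts (path_forest n k)" and ?E = "parcs (path_forest n k)"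
  have fin: "finite ?V" using assms by (simp add: path_forest_verts_eq)
  have sub: "?E \<subseteq> ?V \<times> ?V" by (auto simp: path_forest_arcs)
  have "finite ?E" using finite_subset[OF sub] fin by simp
  moreover have "symmetric (with_proj (path_forest n k))"
    by (auto simp: symmetric_def path_forest_arcs intro!: symI)
  ultimately show ?thesis
    using fin sub by unfold_locales (auto simp: path_forest_arcs)
qed

lemma path_forest_card_verts:
  assumes "k \<ge> 1" "2 * k \<le> n" shows "card (pverts (path_forest n k)) = n"
proof -
  have "card (pverts (path_forest n k)) = card ({..<k - 1} \<times> {..<2::nat}) + card ({k - 1} \<times> {..<n - 2 * k + 2})"
    unfolding path_forest_verts_eq[OF assms(1)] by (rule card_Un_disjoint) auto
  thus ?thesis using assms by (simp add: card_cartesian_product)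
qed

text \<open>In any set of vertices, one with the largest position can only have its predecessor as a
  neighbour.\<close>

lemma path_forest_acyclic:
  assumes "k \<ge> 1" shows "acyclic_on (parcs (path_forest n k)) (pverts (path_forest n k))"
  unfolding acyclic_on_def
proof (intro allI impI)
  fix U assume U: "U \<subseteq> pverts (path_forest n k)" "U \<noteq> {}"
  have "finite U" by (rule finite_subset[OF U(1)]) (simp add: path_forest_verts_eq[OF assms])
  hence "Max (snd ` U) \<in> snd ` U" using U(2) by (intro Max_in) auto
  then obtain i a where ia: "(i, a) \<in> U" "a = Max (snd ` U)" by auto
  have "b \<le> a" if "(j, b) \<in> U" for j b
    unfolding ia(2) using that \<open>finite U\<close> by (intro Max_ge) force+
  hence "nbrs (parcs (path_forest n k)) U (i, a) \<subseteq> {(i, a - 1)}"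
    by (fastforce simp: nbrs_def path_forest_arcs)
  hence "card (nbrs (parcs (path_forest n k)) U (i, a)) \<le> 1"
    using card_mono[of "{(i, a - 1)}"] by simp
  thus "\<exists>v\<in>U. card (nbrs (parcs (path_forest n k)) U v) \<le> 1" using ia by blast
qed

lemma path_forest_card_edges:
  assumes "k \<ge> 1" "2 * k \<le> n"
  shows "card (edges_on (parcs (path_forest n k)) (pverts (path_forest n k))) = n - k"
proof -
  \<comment> \<open>Edges are indexed by their lower ends: one for each P_2 and n - 2 k + 1 for the
    long path.\<close>
  let ?I = "{..<k - 1} \<times> {..<1} \<union> {k - 1} \<times> {..<n - 2 * k + 1}" and ?g = "\<lambda>(i, a). {(i, a), (i, Suc a)} :: (nat \<times> nat) set"
  have mem: "(i, a) \<in> ?I \<longleftrightarrow> (i, Suc a) \<in> pverts (path_forest n k)" for i a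
    using assms by (auto simp: path_forest_verts split: if_splits)
  have "edges_on (parcs (path_forest n k)) (pverts (path_forest n k)) = ?g ` ?I"
  proof (intro equalityI subsetI)
    fix e assume "e \<in> edges_on (parcs (path_forest n k)) (pverts (path_forest n k))"
    then obtain p q where e: "e = {p, q}" "(p, q) \<in> parcs (path_forest n k)"
      by (auto simp: edges_on_def)
    obtain i a where p: "p = (i, a)" by (cases p)
    obtain j b where q: "q = (j, b)" by (cases q)
    have ij: "j = i" "(i, a) \<in> pverts (path_forest n k)" "(i, b) \<in> pverts (path_forest n k)" "b = Suc a \<or> a = Suc b"
      using e(2) by (auto simp: p q path_forest_arcs)
    from ij(4) show "e \<in> ?g ` ?I"
    proof
      assume "b = Suc a"
      hence "(i, a) \<in> ?I" "e = ?g (i, a)" using ij mem[of i a] by (auto simp: e p q)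
      thus ?thesis by (rule rev_image_eqI)
    next
      assume "a = Suc b"
      hence "(i, b) \<in> ?I" "e = ?g (i, b)" using ij mem[of i b] by (auto simp: e p q)
      thus ?thesis by (rule rev_image_eqI)
    qed
  next
    fix e assume "e \<in> ?g ` ?I"
    then obtain i a where ia: "(i, a) \<in> ?I" "e = {(i, a), (i, Suc a)}" by auto
    hence "(i, Suc a) \<in> pverts (path_forest n k)" using mem by blast
    hence "(i, a) \<in> pverts (path_forest n k)" "(i, Suc a) \<in> pverts (path_forest n k)"
      "((i, a), (i, Suc a)) \<in> parcs (path_forest n k)"
      by (auto simp: path_forest_arcs path_forest_verts split: if_splits)
    thus "e \<in> edges_on (parcs (path_forest n k)) (pverts (path_forest n k))"
      unfolding edges_on_def ia(2) by blast
  qed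
  moreover have "inj_on ?g ?I"
  proof (rule inj_onI)
    fix p q assume "?g p = ?g q"
    thus "p = q" by (cases p; cases q) (auto simp: doubleton_eq_iff)
  qed
  moreover have "card ?I = card ({..<k - 1} \<times> {..<1::nat}) + card ({k - 1} \<times> {..<n - 2 * k + 1})"
    by (rule card_Un_disjoint) auto
  ultimately show ?thesis using assms by (simp add: card_image card_cartesian_product)
qed

lemma path_forest_det:
  assumes k: "k \<ge> 1" and x: "x > 0"
  shows "graph_det (parcs (path_forest n k)) (\<i> * of_real x) (pverts (path_forest n k)) =
    of_real ((1 + x\<^sup>2) ^ (k - 1) * path_poly (x\<^sup>2) (n - 2 * k + 2))"
proof -
  let ?E = "parcs (path_forest n k)" and ?V = "pverts (path_forest n k)" and ?L = "n - 2 * k + 2"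
  interpret simple_graph ?E by (intro pair_graph_simple_graph path_forest_pair_graph k)
  let ?D = "graph_det ?E (\<i> * of_real x)"
  have path: "?D ({k - 1} \<times> {..<m}) = of_real (path_poly (x\<^sup>2) m)" if "m \<le> ?L" for m
    using that
  proof (induction "x\<^sup>2" m rule: path_poly.induct)
    case 1
    thus ?case by (simp add: graph_det_def)
  next
    case 2
    have "?D ({k - 1} \<times> {..<Suc 0}) = ?D ({k - 1} \<times> {..<Suc 0} - {(k - 1, 0)})"
      by (rule graph_det_isolated) (auto simp: nbrs_def path_forest_arcs)
    also have "{k - 1} \<times> {..<Suc 0} - {(k - 1, 0)} = {}" by auto
    finally show ?case by (simp add: graph_det_def)
  next
    case (3 m)
    let ?W = "{k - 1} \<times> {..<Suc (Suc m)}"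
    have "nbrs ?E ?W (k - 1, Suc m) = {(k - 1, m)}"
      using 3(3) k by (auto simp: nbrs_def path_forest_arcs path_forest_verts)
    hence "?D ?W = ?D (?W - {(k - 1, Suc m)}) + of_real (x\<^sup>2) * ?D (?W - {(k - 1, Suc m), (k - 1, m)})"
      by (intro graph_det_leaf_imaginary) auto
    also have "?W - {(k - 1, Suc m)} = {k - 1} \<times> {..<Suc m}" by auto
    also have "?W - {(k - 1, Suc m), (k - 1, m)} = {k - 1} \<times> {..<m}" by auto
    finally show ?case using 3 by simp
  qed
  \<comment> \<open>\<open>W j\<close> is the vertex set left after the components with index below
    \<open>j\<close> are removed; each removal splits off the factor of a P_2.\<close>
  define W where "W j = {j..<k - 1} \<times> {..<2} \<union> {k - 1} \<times> {..<?L}" for j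
  have "?D (W j) = of_real ((1 + x\<^sup>2) ^ (k - 1 - j) * path_poly (x\<^sup>2) ?L)" if "j \<le> k - 1" for j
    using that
  proof (induction j rule: inc_induct)
    case base
    thus ?case using path[of ?L] by (simp add: W_def)
  next
    case (step j)
    have "nbrs ?E (W j) (j, 1) = {(j, 0)}" "nbrs ?E (W j) (j, 0) = {(j, 1)}"
      using step(1,2) by (auto simp: nbrs_def W_def path_forest_arcs path_forest_verts)
    moreover have "finite (W j)" "(j, 1) \<in> W j" "(j, 0) \<in> W j" using step by (auto simp: W_def)
    ultimately have "?D (W j) = of_real (1 + x\<^sup>2) * ?D (W j - {(j, 1), (j, 0)})"
      by (intro graph_det_edge_component) auto
    also have "W j - {(j, 1), (j, 0)} = W (Suc j)"
      using step(1,2) by (auto simp: W_def less_2_cases_iff le_Suc_eq) 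
    also have "?D (W (Suc j)) = of_real ((1 + x\<^sup>2) ^ (k - 1 - Suc j) * path_poly (x\<^sup>2) ?L)"
      by (rule step.IH)
    also have "of_real (1 + x\<^sup>2) * of_real ((1 + x\<^sup>2) ^ (k - 1 - Suc j) * path_poly (x\<^sup>2) ?L) =
        (of_real ((1 + x\<^sup>2) ^ Suc (k - 1 - Suc j) * path_poly (x\<^sup>2) ?L) :: complex)"
      by simp
    also have "Suc (k - 1 - Suc j) = k - 1 - j" using step(2) by simp
    finally show ?case .
  qed
  from this[of 0] show ?thesis using k by (simp add: W_def path_forest_verts_eq atLeast0LessThan)
qed

section \<open>Comparison of energies\<close>

lemma forests_card_edges:
  assumes "G \<in> forests n k"
  shows "finite (pverts G)" "acyclic_on (parcs G) (pverts G)" "card (pverts G) = n"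
    "card (edges_on (parcs G) (pverts G)) = n - k" "simple_graph (parcs G)" "pair_graph G"
proof -
  show G: "pair_graph G" using assms by (simp add: forests_def undirected_forest_def)
  then interpret pair_graph G .
  show sg: "simple_graph (parcs G)" by (rule pair_graph_simple_graph) fact
  show fin: "finite (pverts G)" by (rule pair_finite_verts)
  show ac: "acyclic_on (parcs G) (pverts G)"
    using assms undirected_forest_iff[OF G] by (simp add: forests_def)
  show "card (pverts G) = n" using assms by (simp add: forests_def)
  thus "card (edges_on (parcs G) (pverts G)) = n - k"
    using simple_graph.card_components[OF sg fin ac] card_sccs_components[OF G] assms
    by (simp add: forests_def)
qed

lemma energy_le:
  assumes "pair_graph G" "pair_graph H"
    and le: "\<And>x. x > 0 \<Longrightarrow> cmod (graph_det (parcs G) (\<i> * of_real x) (pverts G)) \<le>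
      cmod (graph_det (parcs H) (\<i> * of_real x) (pverts H))"
  shows "energy G \<le> energy H"
    and "(\<And>x. x > 0 \<Longrightarrow> cmod (graph_det (parcs G) (\<i> * of_real x) (pverts G)) <
      cmod (graph_det (parcs H) (\<i> * of_real x) (pverts H))) \<Longrightarrow> energy G < energy H"
proof -
  interpret G: pair_graph G by fact
  interpret H: pair_graph H by fact
  interpret sG: simple_graph "parcs G" by (rule pair_graph_simple_graph) fact
  interpret sH: simple_graph "parcs H" by (rule pair_graph_simple_graph) fact
  obtain L where L: "energy G = (\<Sum>a\<in>#L. \<bar>a\<bar>)" "\<And>x. x > 0 \<Longrightarrow>
      (\<Prod>a\<in>#L. 1 + (a * x)\<^sup>2) = (cmod (graph_det (parcs G) (\<i> * of_real x) (pverts G)))\<^sup>2"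
    using energy_spectrum[OF sG.sym_E sG.irrefl_E G.pair_finite_verts] by blast
  obtain R where R: "energy H = (\<Sum>a\<in>#R. \<bar>a\<bar>)" "\<And>x. x > 0 \<Longrightarrow>
      (\<Prod>a\<in>#R. 1 + (a * x)\<^sup>2) = (cmod (graph_det (parcs H) (\<i> * of_real x) (pverts H)))\<^sup>2"
    using energy_spectrum[OF sH.sym_E sH.irrefl_E H.pair_finite_verts] by blast
  have 1: "(\<Prod>a\<in>#L. 1 + (a * x)\<^sup>2) \<le> (\<Prod>a\<in>#R. 1 + (a * x)\<^sup>2)" if "x > 0" for x
    using le[OF that] by (simp add: L(2) R(2) that power_mono)
  show "energy G \<le> energy H" unfolding L R using sum_mset_abs_le(1)[OF 1] .
  assume less: "\<And>x. x > 0 \<Longrightarrow> cmod (graph_det (parcs G) (\<i> * of_real x) (pverts G)) <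
      cmod (graph_det (parcs H) (\<i> * of_real x) (pverts H))"
  have 2: "(\<Prod>a\<in>#L. 1 + (a * x)\<^sup>2) < (\<Prod>a\<in>#R. 1 + (a * x)\<^sup>2)" if "x > 0" for x
    using less[OF that] by (simp add: L(2) R(2) that power_strict_mono)
  show "energy G < energy H" unfolding L R using sum_mset_abs_le(2)[OF 1 2] .
qed

lemma isomorphic_graph_det:
  assumes "pair_graph G" "pair_graph H" "isomorphic G H"
  shows "graph_det (parcs G) c (pverts G) = graph_det (parcs H) c (pverts H)"
proof -
  interpret G: pair_graph G by fact
  obtain f where f: "iso_on (parcs G) (pverts G) H f"
    using assms isomorphic_iff_iso_on by blast
  hence bij: "bij_betw f (pverts G) (pverts H)" by (simp add: iso_on_def)
  show ?thesis
    unfolding graph_det_def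
  proof (rule set_det_bij[OF bij G.pair_finite_verts])
    fix i j assume ij: "i \<in> pverts G" "j \<in> pverts G"
    have "f i = f j \<longleftrightarrow> i = j" using ij bij by (auto simp: bij_betw_def inj_on_eq_iff)
    moreover have "(i, j) \<in> parcs G \<longleftrightarrow> (f i, f j) \<in> parcs H" using ij f by (simp add: iso_on_def)
    ultimately show "(if i = j then 1 else if (i, j) \<in> parcs G then c else 0) =
      (if f i = f j then 1 else if (f i, f j) \<in> parcs H then c else 0)" by simp
  qed
qed

lemma path_forest_in_forests:
  assumes "k \<ge> 1" "2 * k \<le> n" shows "path_forest n k \<in> forests n k"
proof -
  let ?P = "path_forest n k"
  have G: "pair_graph ?P" by (rule path_forest_pair_graph[OF assms(1)])
  then interpret pair_graph ?P .
  have ac: "acyclic_on (parcs ?P) (pverts ?P)" by (rule path_forest_acyclic[OF assms(1)])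
  have "card (components_on (parcs ?P) (pverts ?P)) + (n - k) = n"
    using simple_graph.card_components[OF pair_graph_simple_graph[OF G] pair_finite_verts ac]
    by (simp only: path_forest_card_verts[OF assms] path_forest_card_edges[OF assms])
  hence "card (components_on (parcs ?P) (pverts ?P)) = k" using assms by simp
  thus ?thesis
    using undirected_forest_iff[OF G] ac card_sccs_components[OF G] path_forest_card_verts[OF assms]
    by (simp add: forests_def)
qed

theorem theorem10:
  fixes n k :: nat
  assumes "k \<ge> 1" and "2 * k < n"
  shows "path_forest n k \<in> forests n k \<and>
    (\<forall>G \<in> (forests n k :: 'a pair_pre_digraph set).
       energy G \<le> energy (path_forest n k) \<and>
       (energy G = energy (path_forest n k) \<longleftrightarrow> isomorphic G (path_forest n k)))"
proof (intro conjI ballI)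
  show "path_forest n k \<in> forests n k" using assms by (intro path_forest_in_forests) auto
next
  fix G :: "'a pair_pre_digraph" assume "G \<in> forests n k"
  note G = forests_card_edges[OF this]
  let ?P = "path_forest n k" and ?D = "\<lambda>x. graph_det (parcs G) (\<i> * of_real x) (pverts G)"
  have P: "pair_graph ?P" by (rule path_forest_pair_graph[OF assms(1)])
  have ne: "pverts G \<noteq> {}" using G(3) assms by auto
  have detP: "graph_det (parcs ?P) (\<i> * of_real x) (pverts ?P) = of_real (extremal (x\<^sup>2) n (n - k))"
    and posP: "extremal (x\<^sup>2) n (n - k) > 0" if "x > 0" for x
  proof -
    have t: "x\<^sup>2 > 0" using that by simp
    have "extremal (x\<^sup>2) n (n - k) = (1 + x\<^sup>2) ^ (k - 1) * path_poly (x\<^sup>2) (n - 2 * k + 2)"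
      using assms by (intro extremal_eq[OF t]) auto
    thus "graph_det (parcs ?P) (\<i> * of_real x) (pverts ?P) = of_real (extremal (x\<^sup>2) n (n - k))"
      "extremal (x\<^sup>2) n (n - k) > 0"
      using path_forest_det[OF assms(1) that, of n] path_poly_pos[OF t] t by (simp_all add: add_pos_pos)
  qed
  have D: "cmod (?D x) = Re (?D x)" "Re (?D x) \<le> extremal (x\<^sup>2) n (n - k)" if "x > 0" for x
    using simple_graph.forest_det_bounds[OF G(5,1) ne G(2) that]
    by (simp_all add: cmod_eq_Re G(3,4))
  have le: "cmod (?D x) \<le> cmod (graph_det (parcs ?P) (\<i> * of_real x) (pverts ?P))" if "x > 0" for x
    using D[OF that] posP[OF that] by (simp add: detP[OF that])
  show "energy G \<le> energy ?P" by (rule energy_le(1)[OF G(6) P le])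
  show "energy G = energy ?P \<longleftrightarrow> isomorphic G ?P"
  proof
    assume eq: "energy G = energy ?P"
    \<comment> \<open>If equality failed at every positive x, the comparison would be strict
      everywhere and so would that of the energies. A single point of equality is all that the
      reconstruction needs.\<close>
    have "\<exists>x>0. Re (?D x) = extremal (x\<^sup>2) n (n - k)"
    proof (rule ccontr)
      assume "\<not> ?thesis"
      hence "cmod (?D x) < cmod (graph_det (parcs ?P) (\<i> * of_real x) (pverts ?P))" if "x > 0" for x
        using D[OF that] posP[OF that] that by (auto simp: detP[OF that] order_less_le)
      hence "energy G < energy ?P" by (intro energy_le(2)[OF G(6) P] le)
      thus False using eq by simp
    qed
    then obtain x where "x > 0" "Re (?D x) = extremal (x\<^sup>2) n (n - k)" by blast
    moreover have "n \<le> 2 * (n - k)" "n - (n - k) = k" using assms by auto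
    ultimately have "\<exists>f. iso_on (parcs G) (pverts G) ?P f"
      using simple_graph.extremal_forest_iso[OF G(5,1,2), of x] by (simp add: G(3,4))
    thus "isomorphic G ?P" using isomorphic_iff_iso_on[OF G(6) P] by blast
  next
    assume "isomorphic G ?P"
    note det = isomorphic_graph_det[OF G(6) P this]
    \<comment> \<open>Equal determinants yield both inequalities between the energies, so the
      matrices for the chosen enumerations need not be compared.\<close>
    have "energy ?P \<le> energy G" by (rule energy_le(1)[OF P G(6)]) (simp add: det)
    thus "energy G = energy ?P" using energy_le(1)[OF G(6) P le] by simp
  qed
qed

end
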